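(* Let $\mathcal{A}$ be the collection of Metropolis–Hastings transition kernels $g$ (as defined in the context, in any dimension $d$) with finite mixing time and for which $q_x(y)$ is jointly continuous in $(x,y)$. Then there is a universal constant $0<K<\infty$ and, for all $0<\alpha<0.5$, two additional constants $0<c_\alpha<\infty$, $0<c'_\alpha<\infty$ (depending only on $\alpha$) such that for all $\{g(x,1,\cdot)\}_{x\in X}\in\mathcal{A}$, $$c_\alpha\,T_m\le\ell_H^{(k)}(\alpha)\le c'_\alpha\left(1+\frac{t_L}{k}\right)$$ for all $k\in\mathbb{N}$ with $k>K\min(\gamma^{-1},t_L)\log(t_L)$, where $T_m$ is the mixing time of $G=(g_L^{(k)})_L$, $\ell_H^{(k)}(\alpha)$ is the maximum hitting time of $g_L^{(k)}$, and $t_L$ is the mixing time of $g_L$.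
   Context: Metropolis–Hastings kernel on $X=\mathbb{R}^d$: fix a distribution $\pi$ with continuous density $\rho$ supported on $\mathbb{R}^d$, and a reversible kernel $\{q(x,1,\cdot)\}_{x\in\mathbb{R}^d}$ on $\mathbb{R}^d$ with stationary measure $\nu$, such that each $q(x,1,\cdot)$ has a continuous density $q_x$ and $\nu$ has a continuous density $\phi$. Let $\beta(x,y)=\min\left(1,\frac{\rho(y)q_y(x)}{\rho(x)q_x(y)}\right)$ (with $\beta(x,y)=1$ if the denominator vanishes) and $$g(x,1,A)=\int_A q_x(y)\beta(x,y)\,dy+\mathbf{1}_{x\in A}\int_{\mathbb{R}^d}q_x(y)(1-\beta(x,y))\,dy,\qquad \gamma=\inf_x\int_{\mathbb{R}^d}q_x(y)\beta(x,y)\,dy .$$ Then $g$ is reversible with stationary measure $\pi$. For a kernel $h$: its lazy version is $h_L(x,1,A)=\frac12h(x,1,A)+\frac12\mathbf{1}_{x\in A}$; its $k$-skeleton is $h^{(k)}(x,t,A)=h(x,kt,A)$, where $h(x,t,A)$ is the $t$-step transition probability. Thus $g_L^{(k)}$ is the $k$-skeleton of $g_L$, and $G=(g_L^{(k)})_L$ is the lazy version of $g_L^{(k)}$. The mixing time of a kernel $h$ with stationary distribution $\mu$ is $\min\{t\ge0:\sup_x\|h(x,t,\cdot)-\mu\|\le\frac14\}$, with $\|\mu-\nu\|=\sup_A|\mu(A)-\nu(A)|$. The maximum hitting time of $h$ is $\sup\{\mathbb{E}_x(\tau_A):x\in X,\ A\text{ Borel},\ \mu(A)\ge\alpha\}$,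 where $\tau_A=\min\{t\in\mathbb{N}:X_t\in A\}$ ($0\in\mathbb{N}$) for the chain with kernel $h$ started at $x$. *)

theory Defs
  imports "HOL-Probability.Probability"
begin

text \<open>
  The dimension varies inside the theorem, so R^d is the set of functions nat => real that are
  undefined outside {..<d}, with Lebesgue measure as a product measure. Its sets are the Borel
  sets of R^d. Continuity refers to the product topology on nat => real; since all coordinates
  from d on are constant, this induces the usual topology of R^d.
\<close>

type_synonym point = "nat \<Rightarrow> real"

definition leb :: "nat \<Rightarrow> point measure" where
  "leb d = Pi\<^sub>M {..<d} (\<lambda>_. lborel)"

abbreviation Rd :: "nat \<Rightarrow> point set" where
  "Rd d \<equiv> space (leb d)"


section \<open>Markov kernels\<close>

text \<open>
  A kernel is represented by its one-step law; M is only used as a measurable space.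
\<close>

definition markov_kernel :: "'a measure \<Rightarrow> ('a \<Rightarrow> 'a measure) \<Rightarrow> bool" where
  "markov_kernel M h \<longleftrightarrow> h \<in> measurable M (prob_algebra M)"

primrec steps :: "'a measure \<Rightarrow> ('a \<Rightarrow> 'a measure) \<Rightarrow> nat \<Rightarrow> 'a \<Rightarrow> 'a measure" where
  "steps M h 0 x = return M x"
| "steps M h (Suc t) x = steps M h t x \<bind> h"

text \<open>Taking B to be the whole space gives stationarity of \<open>\<mu>\<close>.\<close>

definition reversible :: "'a measure \<Rightarrow> ('a \<Rightarrow> 'a measure) \<Rightarrow> 'a measure \<Rightarrow> bool" where
  "reversible M h \<mu> \<longleftrightarrow>
     (\<forall>A\<in>sets M. \<forall>B\<in>sets M.
        (\<integral>\<^sup>+x\<in>A. emeasure (h x) B \<partial>\<mu>) = (\<integral>\<^sup>+x\<in>B. emeasure (h x) A \<partial>\<mu>))"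

definition lazy :: "'a measure \<Rightarrow> ('a \<Rightarrow> 'a measure) \<Rightarrow> 'a \<Rightarrow> 'a measure" where
  "lazy M h x = measure_of (space M) (sets M)
     (\<lambda>A. ennreal (1/2) * emeasure (h x) A + ennreal (1/2) * indicator A x)"

definition skeleton :: "'a measure \<Rightarrow> nat \<Rightarrow> ('a \<Rightarrow> 'a measure) \<Rightarrow> 'a \<Rightarrow> 'a measure" where
  "skeleton M k h = steps M h k"

definition tv_dist :: "'a measure \<Rightarrow> 'a measure \<Rightarrow> 'a measure \<Rightarrow> real" where
  "tv_dist M \<mu> \<nu> = (SUP A\<in>sets M. \<bar>measure \<mu> A - measure \<nu> A\<bar>)"

text \<open>The infimum in enat of the empty set is infinity.\<close>

definition mixing_time :: "'a measure \<Rightarrow> ('a \<Rightarrow> 'a measure) \<Rightarrow> 'a measure \<Rightarrow> enat" where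
  "mixing_time M h \<mu> =
     Inf {enat t | t. (SUP x\<in>space M. tv_dist M (steps M h t x) \<mu>) \<le> 1/4}"

text \<open>Law on path space, by the Ionescu-Tulcea theorem, of the chain started at x.\<close>

definition chain :: "'a measure \<Rightarrow> ('a \<Rightarrow> 'a measure) \<Rightarrow> 'a \<Rightarrow> (nat \<Rightarrow> 'a) measure" where
  "chain M h x =
     projective_family.lim UNIV
       (Ionescu_Tulcea.CI
         (\<lambda>i \<omega>. case i of 0 \<Rightarrow> return M x | Suc j \<Rightarrow> h (\<omega> j)) (\<lambda>_. M))
       (\<lambda>_. M)"

definition hitting_time :: "'a set \<Rightarrow> (nat \<Rightarrow> 'a) \<Rightarrow> enat" where
  "hitting_time A \<omega> = Inf {enat t | t. \<omega> t \<in> A}"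

definition max_hitting_time ::
  "'a measure \<Rightarrow> ('a \<Rightarrow> 'a measure) \<Rightarrow> 'a measure \<Rightarrow> real \<Rightarrow> ennreal" where
  "max_hitting_time M h \<mu> \<alpha> =
     Sup {(\<integral>\<^sup>+\<omega>. ennreal_of_enat (hitting_time A \<omega>) \<partial>chain M h x) | x A.
            x \<in> space M \<and> A \<in> sets M \<and> measure \<mu> A \<ge> \<alpha>}"


section \<open>Metropolis--Hastings kernels\<close>

text \<open>
  Here \<open>\<rho>\<close> is the target density, \<open>q x\<close> the density of the proposal from x, and \<open>\<phi>\<close> the density
  of the measure for which the proposal is reversible. That measure must be nonzero, but may be
  infinite: for a symmetric random walk proposal it is Lebesgue measure.
\<close>

abbreviation dens :: "nat \<Rightarrow> (point \<Rightarrow> real) \<Rightarrow> point measure" where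
  "dens d f \<equiv> density (leb d) (\<lambda>x. ennreal (f x))"

definition cont_density :: "nat \<Rightarrow> (point \<Rightarrow> real) \<Rightarrow> bool" where
  "cont_density d f \<longleftrightarrow> continuous_on (Rd d) f \<and> (\<forall>x\<in>Rd d. 0 \<le> f x)"

definition mh_data ::
  "nat \<Rightarrow> (point \<Rightarrow> real) \<Rightarrow> (point \<Rightarrow> point \<Rightarrow> real) \<Rightarrow> (point \<Rightarrow> real) \<Rightarrow> bool" where
  "mh_data d \<rho> q \<phi> \<longleftrightarrow>
     d \<ge> 1 \<and>
     cont_density d \<rho> \<and> prob_space (dens d \<rho>) \<and> closure {x \<in> Rd d. \<rho> x \<noteq> 0} = Rd d \<and>
     (\<forall>x\<in>Rd d. cont_density d (q x)) \<and> markov_kernel (leb d) (\<lambda>x. dens d (q x)) \<and>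
     cont_density d \<phi> \<and> emeasure (dens d \<phi>) (Rd d) \<noteq> 0 \<and>
     reversible (leb d) (\<lambda>x. dens d (q x)) (dens d \<phi>)"

definition mh_accept :: "(point \<Rightarrow> real) \<Rightarrow> (point \<Rightarrow> point \<Rightarrow> real) \<Rightarrow> point \<Rightarrow> point \<Rightarrow> real" where
  "mh_accept \<rho> q x y =
     (if \<rho> x * q x y = 0 then 1 else min 1 ((\<rho> y * q y x) / (\<rho> x * q x y)))"

definition mh_kernel ::
  "nat \<Rightarrow> (point \<Rightarrow> real) \<Rightarrow> (point \<Rightarrow> point \<Rightarrow> real) \<Rightarrow> point \<Rightarrow> point measure" where
  "mh_kernel d \<rho> q x = measure_of (space (leb d)) (sets (leb d))
     (\<lambda>A. (\<integral>\<^sup>+y\<in>A. ennreal (q x y * mh_accept \<rho> q x y) \<partial>leb d)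
        + indicator A x * (\<integral>\<^sup>+y. ennreal (q x y * (1 - mh_accept \<rho> q x y)) \<partial>leb d))"

definition mh_gamma :: "nat \<Rightarrow> (point \<Rightarrow> real) \<Rightarrow> (point \<Rightarrow> point \<Rightarrow> real) \<Rightarrow> ennreal" where
  "mh_gamma d \<rho> q = (INF x\<in>Rd d. \<integral>\<^sup>+y. ennreal (q x y * mh_accept \<rho> q x y) \<partial>leb d)"

text \<open>
  The hypotheses on the data under which the resulting kernel belongs to the collection
  considered in the theorem.
\<close>

definition mh_class ::
  "nat \<Rightarrow> (point \<Rightarrow> real) \<Rightarrow> (point \<Rightarrow> point \<Rightarrow> real) \<Rightarrow> (point \<Rightarrow> real) \<Rightarrow> bool" where
  "mh_class d \<rho> q \<phi> \<longleftrightarrow>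
     mh_data d \<rho> q \<phi> \<and>
     continuous_on (Rd d \<times> Rd d) (\<lambda>(x, y). q x y) \<and>
     mixing_time (leb d) (mh_kernel d \<rho> q) (dens d \<rho>) \<noteq> \<infinity>"

end

theory Submission
  imports Defs
begin

text \<open>
  Let Q be the lazy kernel, P its k-skeleton and f an indicator function.

  Upper bound: a number of steps of Q that is a fixed multiple of \<open>t_L\<close> brings \<open>Q f\<close> uniformly to
  within \<open>\<alpha> / 2\<close> of its mean, so from every state P hits a set of measure at least \<open>\<alpha>\<close> with
  probability at least \<open>\<alpha> / 2\<close> within a multiple of \<open>1 + t_L / k\<close> steps, and one iterates.

  Lower bound: Q is self-adjoint and positive, so the squared increments of \<open>Q^i f\<close>, summed
  over \<open>i \<ge> N\<close>, are at most \<open>1 / (N + 1)\<close> in mean. Hence \<open>i \<mapsto> Q^i f\<close> is nearly constant on a window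
  following a much longer time N, except on a small set of states. The states outside that set at
  which the value is at least (at most) a median, up to a small error, have measure at least \<open>\<alpha>\<close>,
  since \<open>\<alpha> < 1/2\<close>. Started anywhere, P hits them within a multiple of the maximum hitting time;
  so \<open>P^n f\<close> is uniformly close to the median for n of that order, and the lazy version of P has
  mixed.
\<close>

section \<open>Bounded functions under a Markov kernel\<close>

text \<open>The increment bound behind the lower estimate is the spectral inequality that the sum of
  lambda^(2i) (1 - lambda)^2 over i >= N is at most 1/(N + 1) for lambda in [0, 1]. No spectral
  measure is constructed: since Q = (I + h)/2, every positivity that is needed reduces to the L2
  contraction property of h. The obstacle is that a hitting time is random. When P enters the target
  set, the number of steps still to go can be anything up to the deadline, so the value at the entry
  point must be good for a whole window of times at once. This forces control of oscillation instead
  of single times. An L2 estimate gives it only off an exceptional set, and the gap between 1/2, a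
  lower bound for the measure of the two median sets, and \<open>\<alpha>\<close> pays for that set.
  Waiting time and window are both multiples of k steps of Q, so k cancels from their ratio and the
  constants depend on \<open>\<alpha>\<close> alone. Rounding a multiple of the maximum hitting time
  up to an integer costs only a constant factor because that time is at least 1; this comes from the
  absence of atoms in the target law.\<close>

definition bounded_measurable :: "'a measure \<Rightarrow> ('a \<Rightarrow> real) \<Rightarrow> bool" where
  "bounded_measurable M u \<longleftrightarrow> u \<in> borel_measurable M \<and> (\<exists>B. \<forall>x\<in>space M. \<bar>u x\<bar> \<le> B)"

lemma bounded_measurableI:
  assumes "u \<in> borel_measurable M" "\<And>x. x \<in> space M \<Longrightarrow> \<bar>u x\<bar> \<le> B"
  shows "bounded_measurable M u"
  using assms unfolding bounded_measurable_def by blast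

lemma bounded_measurable_measurable [measurable_dest]:
  "bounded_measurable M u \<Longrightarrow> u \<in> borel_measurable M"
  by (simp add: bounded_measurable_def)

lemma bounded_measurable_const [simp]: "bounded_measurable M (\<lambda>_. c)"
  by (rule bounded_measurableI[where B="\<bar>c\<bar>"]) auto

lemma bounded_measurable_indicator [simp]:
  "A \<in> sets M \<Longrightarrow> bounded_measurable M (indicator A)"
  by (rule bounded_measurableI[where B=1]) (auto split: split_indicator)

lemma bounded_measurable_add:
  assumes "bounded_measurable M u" "bounded_measurable M v"
  shows "bounded_measurable M (\<lambda>x. u x + v x)"
proof -
  from assms obtain B C where "\<forall>x\<in>space M. \<bar>u x\<bar> \<le> B" "\<forall>x\<in>space M. \<bar>v x\<bar> \<le> C"
    unfolding bounded_measurable_def by blast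
  then show ?thesis
    using assms by (intro bounded_measurableI[where B="B + C"]) (auto simp: bounded_measurable_def, fastforce)
qed

lemma bounded_measurable_mult:
  assumes "bounded_measurable M u" "bounded_measurable M v"
  shows "bounded_measurable M (\<lambda>x. u x * v x)"
proof -
  from assms obtain B C where *: "\<forall>x\<in>space M. \<bar>u x\<bar> \<le> B" "\<forall>x\<in>space M. \<bar>v x\<bar> \<le> C"
    unfolding bounded_measurable_def by blast
  have "\<bar>u x * v x\<bar> \<le> B * C" if "x \<in> space M" for x
  proof -
    have "\<bar>u x\<bar> * \<bar>v x\<bar> \<le> B * C"
      using * that by (intro mult_mono) (auto intro: order_trans[OF abs_ge_zero])
    then show ?thesis by (simp add: abs_mult)
  qed
  then show ?thesis
    using assms by (intro bounded_measurableI[where B="B * C"]) (auto simp: bounded_measurable_def)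
qed

lemma bounded_measurable_minus:
  "bounded_measurable M u \<Longrightarrow> bounded_measurable M (\<lambda>x. - u x)"
  using bounded_measurable_mult[OF bounded_measurable_const[of M "-1"], of u] by simp

lemma bounded_measurable_diff:
  "bounded_measurable M u \<Longrightarrow> bounded_measurable M v \<Longrightarrow> bounded_measurable M (\<lambda>x. u x - v x)"
  using bounded_measurable_add[OF _ bounded_measurable_minus, of M u v] by simp

lemma bounded_measurable_power2:
  "bounded_measurable M u \<Longrightarrow> bounded_measurable M (\<lambda>x. (u x)\<^sup>2)"
  unfolding power2_eq_square by (rule bounded_measurable_mult)

lemma bounded_measurable_sum:
  "(\<And>i. i \<in> I \<Longrightarrow> bounded_measurable M (u i)) \<Longrightarrow> bounded_measurable M (\<lambda>x. \<Sum>i\<in>I. u i x)"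
  by (induction I rule: infinite_finite_induct) (auto intro: bounded_measurable_add)

lemmas bounded_measurable_intros = bounded_measurable_add bounded_measurable_mult
  bounded_measurable_diff bounded_measurable_power2 bounded_measurable_sum bounded_measurable_minus
  bounded_measurable_const bounded_measurable_indicator

lemma bounded_measurable_integrable:
  assumes "bounded_measurable M u" "prob_space N" "sets N = sets M"
  shows "integrable N u"
proof -
  interpret prob_space N by fact
  have sp: "space N = space M" using assms(3) by (rule sets_eq_imp_space_eq)
  from assms obtain B where "\<forall>x\<in>space M. \<bar>u x\<bar> \<le> B" and [measurable]: "u \<in> borel_measurable M"
    unfolding bounded_measurable_def by blast
  moreover have "u \<in> borel_measurable N"
    unfolding measurable_cong_sets[OF assms(3) refl] by measurable
  ultimately show ?thesis
    by (intro integrable_const_bound[where B=B]) (auto simp: sp)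
qed

text \<open>The averaging operator of the kernel. Its iterates on indicators are the transition
  probabilities, so mixing and hitting become statements about functions instead of
  measures.\<close>

definition kact :: "('a \<Rightarrow> 'a measure) \<Rightarrow> ('a \<Rightarrow> real) \<Rightarrow> 'a \<Rightarrow> real" where
  "kact h u x = (\<integral>y. u y \<partial>h x)"

locale kernel =
  fixes M :: "'a measure" and h :: "'a \<Rightarrow> 'a measure"
  assumes markov: "markov_kernel M h"
begin

lemma kernel_measurable [measurable]: "h \<in> M \<rightarrow>\<^sub>M prob_algebra M"
  using markov by (simp add: markov_kernel_def)

lemma kernel_measurable' [measurable]: "h \<in> M \<rightarrow>\<^sub>M subprob_algebra M"
  by (rule measurable_prob_algebraD) (rule kernel_measurable)

lemma prob_kernel: "x \<in> space M \<Longrightarrow> prob_space (h x)"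
  using measurable_space[OF kernel_measurable] by (simp add: space_prob_algebra)

lemma sets_kernel': "x \<in> space M \<Longrightarrow> sets (h x) = sets M"
  using measurable_space[OF kernel_measurable] by (simp add: space_prob_algebra)

lemma space_kernel: "x \<in> space M \<Longrightarrow> space (h x) = space M"
  using sets_kernel' by (rule sets_eq_imp_space_eq)

lemma integrable_kernel: "bounded_measurable M u \<Longrightarrow> x \<in> space M \<Longrightarrow> integrable (h x) u"
  by (rule bounded_measurable_integrable) (auto simp: prob_kernel sets_kernel')

lemma kact_mono:
  assumes "bounded_measurable M u" "bounded_measurable M v" "x \<in> space M"
    "\<And>y. y \<in> space M \<Longrightarrow> u y \<le> v y"
  shows "kact h u x \<le> kact h v x"
  unfolding kact_def using assms by (intro integral_mono integrable_kernel) (auto simp: space_kernel)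

lemma kact_const: "x \<in> space M \<Longrightarrow> kact h (\<lambda>_. c) x = c"
  unfolding kact_def using prob_space.prob_space[OF prob_kernel] by simp

lemma kact_bounds:
  assumes "bounded_measurable M u" "x \<in> space M" "\<And>y. y \<in> space M \<Longrightarrow> a \<le> u y \<and> u y \<le> b"
  shows "a \<le> kact h u x" "kact h u x \<le> b"
  using kact_mono[of "\<lambda>_. a" u x] kact_mono[of u "\<lambda>_. b" x] assms by (auto simp: kact_const)

lemma kact_cong:
  "x \<in> space M \<Longrightarrow> (\<And>y. y \<in> space M \<Longrightarrow> u y = v y) \<Longrightarrow> kact h u x = kact h v x"
  unfolding kact_def by (intro Bochner_Integration.integral_cong) (auto simp: space_kernel)

lemma kact_measurable [measurable]: "u \<in> borel_measurable M \<Longrightarrow> kact h u \<in> borel_measurable M"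
  unfolding kact_def[abs_def]
  by (rule measurable_compose[OF kernel_measurable' integral_measurable_subprob_algebra])

lemma kact_bounded_measurable:
  assumes "bounded_measurable M u" shows "bounded_measurable M (kact h u)"
proof -
  from assms obtain B where "\<forall>x\<in>space M. \<bar>u x\<bar> \<le> B" unfolding bounded_measurable_def by blast
  then show ?thesis
    using kact_bounds[OF assms, of _ "-B" B] assms
    by (intro bounded_measurableI[where B=B]) (auto simp: abs_le_iff minus_le_iff)
qed

lemma kact_iter_bounded_measurable:
  "bounded_measurable M u \<Longrightarrow> bounded_measurable M ((kact h ^^ n) u)"
  by (induction n) (auto intro: kact_bounded_measurable)

lemma kact_add:
  "bounded_measurable M u \<Longrightarrow> bounded_measurable M v \<Longrightarrow> x \<in> space M \<Longrightarrow>
    kact h (\<lambda>x. u x + v x) x = kact h u x + kact h v x"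
  unfolding kact_def by (intro Bochner_Integration.integral_add integrable_kernel)

lemma kact_diff:
  "bounded_measurable M u \<Longrightarrow> bounded_measurable M v \<Longrightarrow> x \<in> space M \<Longrightarrow>
    kact h (\<lambda>x. u x - v x) x = kact h u x - kact h v x"
  unfolding kact_def by (intro Bochner_Integration.integral_diff integrable_kernel)

lemma kact_cmult: "kact h (\<lambda>x. c * u x) x = c * kact h u x"
  unfolding kact_def by simp

lemma kact_iter_bounds:
  assumes "bounded_measurable M u" "\<And>y. y \<in> space M \<Longrightarrow> a \<le> u y \<and> u y \<le> b" "x \<in> space M"
  shows "a \<le> (kact h ^^ n) u x \<and> (kact h ^^ n) u x \<le> b"
  using assms(3)
proof (induction n arbitrary: x)
  case (Suc n)
  then show ?case
    using kact_bounds[OF kact_iter_bounded_measurable[OF assms(1)], of x a n b] by simp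
qed (use assms in auto)

lemma kact_iter_cong:
  assumes "\<And>y. y \<in> space M \<Longrightarrow> u y = v y"
  shows "x \<in> space M \<Longrightarrow> (kact h ^^ n) u x = (kact h ^^ n) v x"
  by (induction n arbitrary: x) (auto intro: assms kact_cong)

lemma steps_measurable [measurable]: "steps M h n \<in> M \<rightarrow>\<^sub>M prob_algebra M"
proof (induction n)
  case 0
  have "steps M h 0 = return M" by (simp add: fun_eq_iff)
  then show ?case by (auto intro!: measurable_prob_algebraI prob_space_return)
next
  case (Suc n)
  have "steps M h (Suc n) = (\<lambda>x. steps M h n x \<bind> h)" by (simp add: fun_eq_iff)
  then show ?case
    using measurable_bind_prob_space[OF Suc kernel_measurable] by simp
qed

lemma steps_markov: "markov_kernel M (steps M h n)"
  by (simp add: markov_kernel_def)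

lemma prob_steps: "x \<in> space M \<Longrightarrow> prob_space (steps M h n x)"
  using measurable_space[OF steps_measurable] by (simp add: space_prob_algebra)

lemma sets_steps: "x \<in> space M \<Longrightarrow> sets (steps M h n x) = sets M"
  using measurable_space[OF steps_measurable] by (simp add: space_prob_algebra)

text \<open>\<open>steps\<close> appends the new step at the end of the path, so unfolding it
  replaces \<open>u\<close> by \<open>kact h u\<close>. The induction therefore runs over all
  \<open>u\<close>.\<close>

lemma kact_steps:
  assumes "bounded_measurable M u" "x \<in> space M"
  shows "kact (steps M h n) u x = (kact h ^^ n) u x"
  using assms(1)
proof (induction n arbitrary: u)
  case 0
  then show ?case
    using assms(2) by (simp add: kact_def integral_return bounded_measurable_measurable)
next
  case (Suc n)
  then obtain B where B: "\<forall>x\<in>space M. \<bar>u x\<bar> \<le> B" unfolding bounded_measurable_def by blast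
  interpret S: prob_space "steps M h n x" using assms(2) by (rule prob_steps)
  have sp: "space (steps M h n x) = space M"
    using sets_steps[OF assms(2)] by (rule sets_eq_imp_space_eq)
  have "kact (steps M h (Suc n)) u x = (\<integral>y. u y \<partial>(steps M h n x \<bind> h))"
    by (simp add: kact_def)
  also have "\<dots> = (\<integral>z. (\<integral>y. u y \<partial>h z) \<partial>steps M h n x)"
  proof (rule integral_bind[where K=M and B=B and B'=1])
    show "h \<in> steps M h n x \<rightarrow>\<^sub>M subprob_algebra M"
      using measurable_cong_sets[OF sets_steps[OF assms(2)] refl] kernel_measurable' by blast
    show "u \<in> borel_measurable M" using Suc.prems by (rule bounded_measurable_measurable)
    show "finite_measure (steps M h n x)" by unfold_locales
    show "AE z in steps M h n x. emeasure (h z) (space (h z)) \<le> ennreal 1"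
      by (rule AE_I2) (simp add: sp prob_space.emeasure_space_1[OF prob_kernel])
  qed (use B in auto)
  also have "\<dots> = kact (steps M h n) (kact h u) x" by (simp add: kact_def[abs_def])
  also have "\<dots> = (kact h ^^ n) (kact h u) x"
    by (rule Suc.IH) (rule kact_bounded_measurable[OF Suc.prems])
  finally show ?case by (simp only: funpow_Suc_right comp_apply)
qed

lemma measure_steps:
  assumes "A \<in> sets M" "x \<in> space M"
  shows "measure (steps M h n x) A = (kact h ^^ n) (indicator A) x"
proof -
  have "(kact h ^^ n) (indicator A) x = (\<integral>y. indicator A y \<partial>steps M h n x)"
    using kact_steps[of "indicator A" x n] assms by (simp add: kact_def)
  also have "\<dots> = measure (steps M h n x) A"
    using assms prob_steps[OF assms(2), of n, THEN prob_space.finite_measure]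
    by (simp add: sets_steps assms finite_measure.emeasure_finite less_top[symmetric])
  finally show ?thesis by simp
qed

end

section \<open>Total variation and mixing times\<close>

lemma abs_measure_diff_le_tv_dist:
  assumes "prob_space \<mu>" "prob_space \<nu>" "A \<in> sets M"
  shows "\<bar>measure \<mu> A - measure \<nu> A\<bar> \<le> tv_dist M \<mu> \<nu>"
  unfolding tv_dist_def
proof (rule cSUP_upper[OF assms(3)])
  have "\<bar>measure \<mu> B - measure \<nu> B\<bar> \<le> 1" for B
    using prob_space.prob_le_1[OF assms(1), of B] prob_space.prob_le_1[OF assms(2), of B]
    by (smt (verit) measure_nonneg)
  then show "bdd_above ((\<lambda>A. \<bar>measure \<mu> A - measure \<nu> A\<bar>) ` sets M)"
    by (auto intro!: bdd_aboveI[where M=1])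
qed

lemma tv_dist_le:
  assumes "\<And>A. A \<in> sets M \<Longrightarrow> \<bar>measure \<mu> A - measure \<nu> A\<bar> \<le> c"
  shows "tv_dist M \<mu> \<nu> \<le> c"
  unfolding tv_dist_def using assms by (intro cSUP_least) (auto intro: sets.top)

lemma (in kernel) mixing_time_leI:
  assumes "space M \<noteq> {}"
    and "\<And>x A. x \<in> space M \<Longrightarrow> A \<in> sets M \<Longrightarrow> \<bar>measure (steps M h t x) A - measure \<pi> A\<bar> \<le> 1/4"
  shows "mixing_time M h \<pi> \<le> enat t"
proof -
  have "(SUP x\<in>space M. tv_dist M (steps M h t x) \<pi>) \<le> 1/4"
    using assms by (intro cSUP_least tv_dist_le)
  then show ?thesis unfolding mixing_time_def by (intro Inf_lower) blast
qed

text \<open>A finite infimum in \<open>enat\<close> is attained, so the time \<open>t\<close> itself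
  satisfies the defining bound. All distances are at most 1, so the real supremum over states is a
  genuine upper bound.\<close>

lemma (in kernel) mixing_time_eqD:
  assumes "mixing_time M h \<pi> = enat t" "prob_space \<pi>" "x \<in> space M" "A \<in> sets M"
  shows "\<bar>measure (steps M h t x) A - measure \<pi> A\<bar> \<le> 1/4"
proof -
  let ?T = "{enat t | t. (SUP x\<in>space M. tv_dist M (steps M h t x) \<pi>) \<le> 1/4}"
  have "?T \<noteq> {}"
  proof
    assume "?T = {}"
    then show False using assms(1) unfolding mixing_time_def by (simp only: Inf_enat_def) simp
  qed
  then have "Inf ?T \<in> ?T"
    unfolding Inf_enat_def by (auto intro: LeastI)
  then have 1: "(SUP x\<in>space M. tv_dist M (steps M h t x) \<pi>) \<le> 1/4"
    using assms(1) unfolding mixing_time_def by auto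
  have le1: "tv_dist M (steps M h t y) \<pi> \<le> 1" if "y \<in> space M" for y
    using prob_space.prob_le_1[OF prob_steps[OF that], of t] prob_space.prob_le_1[OF assms(2)]
    by (intro tv_dist_le) (smt (verit) measure_nonneg)
  have "\<bar>measure (steps M h t x) A - measure \<pi> A\<bar> \<le> tv_dist M (steps M h t x) \<pi>"
    using assms by (intro abs_measure_diff_le_tv_dist prob_steps)
  also have "\<dots> \<le> (SUP x\<in>space M. tv_dist M (steps M h t x) \<pi>)"
    using le1 assms(3) by (intro cSUP_upper bdd_aboveI[where M=1]) auto
  finally show ?thesis using 1 by simp
qed

text \<open>Dividing the range into n levels replaces u, up to 1/n, by an average of indicators of its
  superlevel sets.\<close>

lemma integral_diff_le_of_measure_diff_le:
  fixes u :: "'a \<Rightarrow> real"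
  assumes "prob_space \<mu>" "prob_space \<nu>" "sets \<mu> = sets M" "sets \<nu> = sets M"
    and diff: "\<And>A. A \<in> sets M \<Longrightarrow> \<bar>measure \<mu> A - measure \<nu> A\<bar> \<le> \<delta>"
    and [measurable]: "u \<in> borel_measurable M" and u: "\<And>x. x \<in> space M \<Longrightarrow> 0 \<le> u x \<and> u x \<le> 1"
  shows "\<bar>(\<integral>x. u x \<partial>\<mu>) - (\<integral>x. u x \<partial>\<nu>)\<bar> \<le> \<delta>"
proof (rule field_le_epsilon)
  fix e :: real assume "e > 0"
  obtain n where n: "real n > 1 / e" using reals_Archimedean2 by blast
  with \<open>e > 0\<close> have n0: "n > 0" by (cases n) auto
  have ne: "1 / n < e" using n n0 \<open>e > 0\<close> by (simp add: field_simps)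
  define L where "L j = {x \<in> space M. real j \<le> n * u x}" for j
  have [measurable]: "L j \<in> sets M" for j unfolding L_def by measurable
  define g where "g x = (\<Sum>j\<in>{1..n}. indicator (L j) x) / n" for x
  have g: "g x \<le> u x \<and> u x \<le> g x + 1 / n" if x: "x \<in> space M" for x
  proof -
    have "(\<Sum>j\<in>{1..n}. indicator (L j) x) = (\<Sum>j\<in>{1..n}. if real j \<le> n * u x then 1 else 0 :: real)"
      using x by (intro sum.cong) (auto simp: L_def indicator_def)
    also have "\<dots> = (\<Sum>j\<in>{j\<in>{1..n}. real j \<le> n * u x}. 1)"
      by (rule sum.inter_filter[symmetric]) simp
    also have "{j\<in>{1..n}. real j \<le> n * u x} = {1..nat \<lfloor>n * u x\<rfloor>}"
    proof -
      have "n * u x \<le> real n * 1" using u[OF x] by (intro mult_left_mono) auto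
      then have "nat \<lfloor>n * u x\<rfloor> \<le> n" by linarith
      then show ?thesis using u[OF x] \<open>n * u x \<le> real n * 1\<close>
        by (auto simp: le_nat_iff le_floor_iff)
    qed
    finally have "(\<Sum>j\<in>{1..n}. indicator (L j) x) = (of_int \<lfloor>n * u x\<rfloor> :: real)"
      using u[OF x] by simp
    then have gx: "g x = of_int \<lfloor>n * u x\<rfloor> / n" by (simp add: g_def)
    have "of_int \<lfloor>n * u x\<rfloor> \<le> n * u x" "n * u x \<le> of_int \<lfloor>n * u x\<rfloor> + 1" by linarith+
    then show ?thesis unfolding gx using n0 by (simp add: field_simps)
  qed
  have bu: "bounded_measurable M u" using u by (intro bounded_measurableI[where B=1]) auto
  have bg: "bounded_measurable M g"
    unfolding g_def[abs_def] divide_inverse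
    by (intro bounded_measurable_intros) auto
  have *: "(\<integral>x. g x \<partial>N) \<le> (\<integral>x. u x \<partial>N) \<and> (\<integral>x. u x \<partial>N) \<le> (\<integral>x. g x \<partial>N) + 1 / n"
    "(\<integral>x. g x \<partial>N) = (\<Sum>j\<in>{1..n}. measure N (L j)) / n"
    if N: "prob_space N" "sets N = sets M" for N
  proof -
    interpret prob_space N by fact
    have sp: "space N = space M" using N(2) by (rule sets_eq_imp_space_eq)
    have iu: "integrable N u" and ig: "integrable N g"
      using bu bg N by (auto intro: bounded_measurable_integrable)
    have "(\<integral>x. u x \<partial>N) \<le> (\<integral>x. g x + 1 / n \<partial>N)"
      using iu ig g by (intro integral_mono) (auto simp: sp)
    then show "(\<integral>x. g x \<partial>N) \<le> (\<integral>x. u x \<partial>N) \<and> (\<integral>x. u x \<partial>N) \<le> (\<integral>x. g x \<partial>N) + 1 / n"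
      using iu ig g prob_space by (auto simp: sp intro: integral_mono)
    have "(\<integral>x. (\<Sum>j\<in>{1..n}. indicator (L j) x :: real) \<partial>N) = (\<Sum>j\<in>{1..n}. \<integral>x. indicator (L j) x \<partial>N)"
      by (intro Bochner_Integration.integral_sum bounded_measurable_integrable[OF bounded_measurable_indicator] N) (auto simp: N(2))
    also have "\<dots> = (\<Sum>j\<in>{1..n}. measure N (L j))"
      by (simp add: N(2))
    finally show "(\<integral>x. g x \<partial>N) = (\<Sum>j\<in>{1..n}. measure N (L j)) / n"
      by (simp add: g_def[abs_def])
  qed
  have "\<bar>(\<Sum>j\<in>{1..n}. measure \<mu> (L j)) - (\<Sum>j\<in>{1..n}. measure \<nu> (L j))\<bar>
    \<le> (\<Sum>j\<in>{1..n}. \<bar>measure \<mu> (L j) - measure \<nu> (L j)\<bar>)"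
    unfolding sum_subtractf[symmetric] by (rule sum_abs)
  also have "\<dots> \<le> (\<Sum>j\<in>{1..n}. \<delta>)" by (intro sum_mono diff) auto
  finally have "\<bar>((\<Sum>j\<in>{1..n}. measure \<mu> (L j)) - (\<Sum>j\<in>{1..n}. measure \<nu> (L j))) / n\<bar> \<le> \<delta>"
    using n0 by (simp add: abs_divide field_simps)
  then have "\<bar>(\<integral>x. g x \<partial>\<mu>) - (\<integral>x. g x \<partial>\<nu>)\<bar> \<le> \<delta>"
    unfolding *(2)[OF assms(1,3)] *(2)[OF assms(2,4)] diff_divide_distrib .
  then show "\<bar>(\<integral>x. u x \<partial>\<mu>) - (\<integral>x. u x \<partial>\<nu>)\<bar> \<le> \<delta> + e"
    using *(1)[OF assms(1,3)] *(1)[OF assms(2,4)] ne by linarith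
qed

text \<open>Averages of values in [c - e, c + e] stay there. This carries a bound reached at one
  time to all later times.\<close>

lemma (in kernel) kact_iter_deviation_mono:
  assumes "bounded_measurable M u" "\<And>x. x \<in> space M \<Longrightarrow> \<bar>u x - c\<bar> \<le> e" "x \<in> space M"
  shows "\<bar>(kact h ^^ n) u x - c\<bar> \<le> e"
proof -
  have "c - e \<le> u y \<and> u y \<le> c + e" if "y \<in> space M" for y
    using assms(2)[OF that] by (auto simp: abs_le_iff)
  from kact_iter_bounds[OF assms(1) this assms(3)]
  have "c - e \<le> (kact h ^^ n) u x \<and> (kact h ^^ n) u x \<le> c + e" .
  then show ?thesis by (auto simp: abs_le_iff)
qed

section \<open>Geometric convergence to a stationary law\<close>

locale stationary_kernel = kernel +
  fixes \<pi> :: "'a measure"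
  assumes prob_pi: "prob_space \<pi>" and sets_pi [measurable_cong]: "sets \<pi> = sets M"
    and stationary: "bounded_measurable M u \<Longrightarrow> (\<integral>x. kact h u x \<partial>\<pi>) = (\<integral>x. u x \<partial>\<pi>)"
begin

lemma space_pi: "space \<pi> = space M" using sets_pi by (rule sets_eq_imp_space_eq)

sublocale pi: prob_space \<pi> by (rule prob_pi)

lemma integrable_pi: "bounded_measurable M u \<Longrightarrow> integrable \<pi> u"
  by (rule bounded_measurable_integrable[OF _ prob_pi sets_pi])

lemma stationary_iter:
  "bounded_measurable M u \<Longrightarrow> (\<integral>x. (kact h ^^ n) u x \<partial>\<pi>) = (\<integral>x. u x \<partial>\<pi>)"
  by (induction n) (simp_all add: stationary kact_iter_bounded_measurable)

text \<open>Total variation at most 1/4 changes the integral of a function by at most a quarter of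
  the length of its range, and here the range has length at most \<open>2 * e\<close>. Stationarity
  keeps the mean fixed under further averaging, so the halving can be repeated; this takes the place
  of submultiplicativity of the distance.\<close>

lemma kact_iter_contraction:
  assumes tl: "mixing_time M h \<pi> = enat t" and bu: "bounded_measurable M u" and "e > 0"
    and u: "\<And>x. x \<in> space M \<Longrightarrow> \<bar>u x - (\<integral>y. u y \<partial>\<pi>)\<bar> \<le> e" and x: "x \<in> space M"
  shows "\<bar>(kact h ^^ t) u x - (\<integral>y. u y \<partial>\<pi>)\<bar> \<le> e / 2"
proof -
  define c where "c = (\<integral>y. u y \<partial>\<pi>)"
  \<comment> \<open>The affine map from [c - e, c + e] onto [0, 1], the range for which integrals
    are compared.\<close>
  define v where "v = (\<lambda>x. (u x - c + e) * (1 / (2 * e)))"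
  have bv: "bounded_measurable M v" unfolding v_def by (intro bounded_measurable_intros bu)
  have uv: "u = (\<lambda>x. v x * (2 * e) + (c - e))" using \<open>e > 0\<close> by (auto simp: v_def)
  have v: "0 \<le> v x \<and> v x \<le> 1" if "x \<in> space M" for x
    using u[OF that] \<open>e > 0\<close> unfolding v_def c_def by (auto simp: field_simps abs_le_iff)
  have "\<bar>(\<integral>y. v y \<partial>steps M h t x) - (\<integral>y. v y \<partial>\<pi>)\<bar> \<le> 1/4"
    using mixing_time_eqD[OF tl prob_pi x] v bv x
    by (intro integral_diff_le_of_measure_diff_le[where M=M])
       (auto simp: prob_steps prob_pi sets_steps sets_pi bounded_measurable_measurable)
  moreover have "(\<integral>y. u y \<partial>N) = 2 * e * (\<integral>y. v y \<partial>N) + (c - e)"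
    if N: "prob_space N" "sets N = sets M" for N
    using bounded_measurable_integrable[OF bv N] prob_space.prob_space[OF N(1)]
      finite_measure.integrable_const[of N "c - e"] prob_space.finite_measure[OF N(1)]
    unfolding uv by simp
  note this[OF prob_steps[OF x, of t] sets_steps[OF x]] this[OF prob_pi sets_pi]
  ultimately have "\<bar>(\<integral>y. u y \<partial>steps M h t x) - (\<integral>y. u y \<partial>\<pi>)\<bar> \<le> 2 * e * (1/4)"
    using \<open>e > 0\<close> by (simp only: diff_add_eq add_diff_cancel_right right_diff_distrib[symmetric] abs_mult) auto
  then show ?thesis using kact_steps[OF bu x, of t] unfolding kact_def by simp
qed

text \<open>An indicator deviates from its mean by at most 1, and each block of \<open>t\<close>
  steps halves the deviation. Steps beyond \<open>n * t\<close> do no harm, which matters because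
  only multiples of the skeleton length will be available.\<close>

lemma kact_iter_indicator_deviation:
  assumes tl: "mixing_time M h \<pi> = enat t" and A: "A \<in> sets M"
    and x: "x \<in> space M" and l: "n * t \<le> l"
  shows "\<bar>(kact h ^^ l) (indicator A) x - measure \<pi> A\<bar> \<le> (1/2)^n"
proof -
  have bA: "bounded_measurable M (indicator A)" using A by simp
  have iA: "(\<integral>y. indicator A y \<partial>\<pi>) = measure \<pi> A" using A by (simp add: sets_pi)
  have 1: "\<bar>(kact h ^^ (n * t)) (indicator A) x - measure \<pi> A\<bar> \<le> (1/2)^n" if "x \<in> space M" for n x
    using that
  proof (induction n arbitrary: x)
    case 0
    show ?case using pi.prob_le_1[of A] measure_nonneg[of \<pi> A] by (cases "x \<in> A") auto
  next
    case (Suc n)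
    let ?u = "(kact h ^^ (n * t)) (indicator A)"
    have bu: "bounded_measurable M ?u" using bA by (rule kact_iter_bounded_measurable)
    have i: "(\<integral>y. ?u y \<partial>\<pi>) = measure \<pi> A" using stationary_iter[OF bA] iA by simp
    have "\<bar>(kact h ^^ t) ?u x - measure \<pi> A\<bar> \<le> (1/2)^n / 2"
      using kact_iter_contraction[OF tl bu, of "(1/2)^n" x] Suc unfolding i by simp
    then show ?case by (simp add: funpow_add)
  qed
  obtain r where r: "l = r + n * t" using l by (metis add.commute le_Suc_ex)
  show ?thesis unfolding r funpow_add comp_apply
    by (rule kact_iter_deviation_mono) (auto intro: 1 x kact_iter_bounded_measurable bA)
qed

end

section \<open>Hitting times\<close>

context kernel begin

text \<open>The probability that the chain avoids A at all of the times 0, ..., n.\<close>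

primrec avoid :: "'a set \<Rightarrow> nat \<Rightarrow> 'a \<Rightarrow> real" where
  "avoid A 0 x = indicator (- A) x"
| "avoid A (Suc n) x = indicator (- A) x * kact h (avoid A n) x"

lemma avoid_bounded_measurable:
  assumes "A \<in> sets M"
  shows "bounded_measurable M (avoid A n)"
proof -
  have "(indicator (- A) :: 'a \<Rightarrow> real) = (\<lambda>x. 1 - indicator A x)"
    by (auto simp: indicator_def)
  then have *: "bounded_measurable M (indicator (- A))"
    using assms by (auto intro!: bounded_measurable_intros)
  show ?thesis
  proof (induction n)
    case 0
    have "avoid A 0 = indicator (- A)" by auto
    then show ?case using * by simp
  next
    case (Suc n)
    have "avoid A (Suc n) = (\<lambda>x. indicator (- A) x * kact h (avoid A n) x)" by auto
    then show ?case using * Suc by (auto intro!: bounded_measurable_intros kact_bounded_measurable)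
  qed
qed

lemma avoid_bounds:
  assumes "A \<in> sets M" "x \<in> space M"
  shows "0 \<le> avoid A n x" "avoid A n x \<le> 1"
proof -
  have "0 \<le> avoid A n x \<and> avoid A n x \<le> 1" using assms(2)
  proof (induction n arbitrary: x)
    case (Suc n)
    then show ?case
      using kact_bounds[OF avoid_bounded_measurable[OF assms(1)], of x 0 n 1]
      by (auto split: split_indicator)
  qed (auto split: split_indicator)
  then show "0 \<le> avoid A n x" "avoid A n x \<le> 1" by auto
qed

text \<open>The Markov property at time \<open>m\<close>: from the state then occupied,
  \<open>A\<close> must be avoided for another \<open>s\<close> steps.\<close>

lemma avoid_add_le:
  assumes A: "A \<in> sets M" and c: "\<And>x. x \<in> space M \<Longrightarrow> avoid A s x \<le> c" and "x \<in> space M"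
  shows "avoid A (m + s) x \<le> c * avoid A m x"
  using assms(3)
proof (induction m arbitrary: x)
  case 0
  then show ?case using c[OF 0] by (cases s) (auto split: split_indicator)
next
  case (Suc m)
  have "kact h (avoid A (m + s)) x \<le> kact h (\<lambda>x. c * avoid A m x) x"
    using Suc A by (intro kact_mono avoid_bounded_measurable bounded_measurable_intros) auto
  then show ?case by (auto simp: kact_cmult split: split_indicator)
qed

text \<open>A path that avoids \<open>A\<close> up to time \<open>s\<close> is in particular outside
  \<open>A\<close> at time \<open>s\<close>.\<close>

lemma avoid_le_kact_iter:
  assumes A: "A \<in> sets M" and "x \<in> space M"
  shows "avoid A s x \<le> 1 - (kact h ^^ s) (indicator A) x"
  using assms(2)
proof (induction s arbitrary: x)
  case (Suc s)
  have b: "bounded_measurable M ((kact h ^^ s) (indicator A))"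
    using A by (intro kact_iter_bounded_measurable) auto
  have "kact h (avoid A s) x \<le> kact h (\<lambda>x. 1 - (kact h ^^ s) (indicator A) x) x"
    using Suc A b by (intro kact_mono avoid_bounded_measurable bounded_measurable_intros) auto
  also have "\<dots> = 1 - (kact h ^^ Suc s) (indicator A) x"
    using Suc b by (simp add: kact_diff kact_const)
  finally have "kact h (avoid A s) x \<le> 1 - (kact h ^^ Suc s) (indicator A) x" .
  moreover have "(kact h ^^ Suc s) (indicator A) x \<le> 1"
    using kact_iter_bounds[of "indicator A" 0 1 x "Suc s"] A Suc by (auto split: split_indicator)
  ultimately show ?case by (auto split: split_indicator)
qed (auto split: split_indicator)

text \<open>The sum is the truncated tail formula for the expected hitting time. Shifting the index
  by \<open>s\<close> costs a factor \<open>1 - p\<close>, so the sum W satisfies W <= s + (1 - p)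
  W. Truncation at \<open>N\<close> keeps W finite, which makes solving for it legitimate.\<close>

lemma sum_avoid_le:
  assumes A: "A \<in> sets M" and p: "0 < p" "p \<le> 1" and x: "x \<in> space M"
    and hit: "\<And>x. x \<in> space M \<Longrightarrow> p \<le> (kact h ^^ s) (indicator A) x"
  shows "(\<Sum>n<N. avoid A n x) \<le> s / p"
proof -
  let ?W = "\<Sum>n<N. avoid A n x"
  have c: "avoid A s x \<le> 1 - p" if "x \<in> space M" for x
    using avoid_le_kact_iter[OF A that, of s] hit[OF that] by simp
  \<comment> \<open>Lengthening the sum by \<open>s\<close> terms makes its shifted part run over
    the same \<open>N\<close> indices as \<open>?W\<close>.\<close>
  have "?W \<le> (\<Sum>n<s+N. avoid A n x)"
    using avoid_bounds[OF A x] by (intro sum_mono2) auto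
  also have "\<dots> = (\<Sum>n<s. avoid A n x) + (\<Sum>n<N. avoid A (n + s) x)"
    by (induction N) (auto simp: add_ac)
  also have "\<dots> \<le> (\<Sum>n<s. 1) + (\<Sum>n<N. (1 - p) * avoid A n x)"
    using avoid_bounds[OF A x] by (intro add_mono sum_mono avoid_add_le[OF A c x])
  also have "\<dots> = s + (1 - p) * ?W" by (simp add: sum_distrib_left)
  finally have "p * ?W \<le> s" by (simp add: algebra_simps)
  then show ?thesis using p by (simp add: field_simps)
qed

lemma avoid_decseq:
  assumes A: "A \<in> sets M" and x: "x \<in> space M" and "m \<le> n"
  shows "avoid A n x \<le> avoid A m x"
proof -
  have "avoid A (m + (n - m)) x \<le> 1 * avoid A m x"
    using A x by (intro avoid_add_le avoid_bounds) auto
  then show ?thesis using assms by simp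
qed

section \<open>The law of the hitting time on path space\<close>

abbreviation path_kernel :: "'a \<Rightarrow> nat \<Rightarrow> (nat \<Rightarrow> 'a) \<Rightarrow> 'a measure" where
  "path_kernel x i \<omega> \<equiv> case i of 0 \<Rightarrow> return M x | Suc j \<Rightarrow> h (\<omega> j)"

lemma Ionescu_Tulcea_path:
  assumes x: "x \<in> space M"
  shows "Ionescu_Tulcea (path_kernel x) (\<lambda>_. M)"
proof (rule Ionescu_Tulcea.intro)
  fix i :: nat
  show "path_kernel x i \<in> Pi\<^sub>M {0..<i} (\<lambda>_. M) \<rightarrow>\<^sub>M subprob_algebra M"
  proof (cases i)
    case 0
    then show ?thesis using x by (auto simp: space_subprob_algebra prob_space_return prob_space_imp_subprob_space intro!: measurable_const)
  next
    case (Suc j)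
    then have "path_kernel x i = (\<lambda>\<omega>. h (\<omega> j))" by (simp add: fun_eq_iff)
    then show ?thesis
      using Suc by (auto intro!: measurable_compose[OF _ kernel_measurable'] measurable_component_singleton)
  qed
next
  fix i :: nat and \<omega> assume "\<omega> \<in> space (Pi\<^sub>M {0..<i} (\<lambda>_. M))"
  then show "prob_space (path_kernel x i \<omega>)"
    using x by (cases i) (auto intro!: prob_space_return prob_kernel simp: space_PiM PiE_iff)
qed

text \<open>Avoidance unrolled from the last step, with a weight \<open>u\<close> on the final
  state. The path measure is built by appending coordinates, so this is the recursion that
  integrating out the newest coordinate produces.\<close>

primrec navoid :: "'a set \<Rightarrow> nat \<Rightarrow> ('a \<Rightarrow> ennreal) \<Rightarrow> 'a \<Rightarrow> ennreal" where
  "navoid A 0 u x = indicator (- A) x * u x"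
| "navoid A (Suc n) u x = navoid A n (\<lambda>y. \<integral>\<^sup>+z. indicator (- A) z * u z \<partial>h y) x"

text \<open>\<open>avoid\<close> conditions on the first step and \<open>navoid\<close> on the last.
  The auxiliary identity peels the first step off \<open>navoid\<close> for every weight, after
  which both obey the same recursion.\<close>

lemma navoid_eq_avoid:
  assumes A: "A \<in> sets M" and x: "x \<in> space M"
  shows "navoid A n (\<lambda>_. 1) x = ennreal (avoid A n x)"
proof -
  have *: "navoid A (Suc n) u x = indicator (- A) x * (\<integral>\<^sup>+z. navoid A n u z \<partial>h x)" for n u x
  proof (induction n arbitrary: u)
    case (Suc n)
    have "navoid A (Suc (Suc n)) u x =
        navoid A (Suc n) (\<lambda>y. \<integral>\<^sup>+z. indicator (- A) z * u z \<partial>h y) x"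
      by (rule navoid.simps(2))
    then show ?case by (simp only: Suc) simp
  next
    case (0 u)
    have "navoid A 0 u = (\<lambda>x. indicator (- A) x * u x)" by auto
    then show ?case by simp
  qed
  show ?thesis
    using x
  proof (induction n arbitrary: x)
    case (Suc n)
    have "(\<integral>\<^sup>+z. navoid A n (\<lambda>_. 1) z \<partial>h x) = (\<integral>\<^sup>+z. ennreal (avoid A n z) \<partial>h x)"
      using Suc by (intro nn_integral_cong) (simp add: space_kernel)
    also have "\<dots> = ennreal (kact h (avoid A n) x)"
      unfolding kact_def using Suc A
      by (intro nn_integral_eq_integral integrable_kernel avoid_bounded_measurable AE_I2)
         (auto simp: space_kernel avoid_bounds)
    finally show ?case unfolding * by (auto split: split_indicator)
  qed (auto split: split_indicator)
qed

text \<open>Coordinate 0 is drawn from the point mass at \<open>x\<close>, so \<open>Suc n\<close>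
  extensions of the empty history \<open>\<lambda>_. undefined\<close> give the joint law of the
  chain at times 0, ..., n. Integrating out the last coordinate turns the weight on it into a weight
  on the previous one, hence the induction over all \<open>u\<close>.\<close>

lemma nn_integral_avoid_path:
  assumes x: "x \<in> space M" and A [measurable]: "A \<in> sets M"
    and "u \<in> borel_measurable M"
  shows "(\<integral>\<^sup>+\<omega>. (\<Prod>i\<le>n. indicator (- A) (\<omega> i)) * u (\<omega> n)
      \<partial>Ionescu_Tulcea.C (path_kernel x) (\<lambda>_. M) 0 (Suc n) (\<lambda>_. undefined)) = navoid A n u x"
  using assms(3)
proof (induction n arbitrary: u)
  interpret IT: Ionescu_Tulcea "path_kernel x" "\<lambda>_. M" using x by (rule Ionescu_Tulcea_path)
  have un: "(\<lambda>_. undefined) \<in> space (Pi\<^sub>M {0..<0::nat} (\<lambda>_. M))" by (auto simp: space_PiM)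
  have mA: "(indicator (- A) :: _ \<Rightarrow> ennreal) \<in> borel_measurable M"
  proof -
    have "(indicator (- A) :: _ \<Rightarrow> ennreal) \<in> borel_measurable M \<longleftrightarrow>
      (indicator (space M - A) :: _ \<Rightarrow> ennreal) \<in> borel_measurable M"
      by (rule measurable_cong) (auto simp: indicator_def)
    then show ?thesis by simp
  qed
  {
    case 0
    note [measurable] = 0 mA
    have "(\<integral>\<^sup>+\<omega>. (\<Prod>i\<le>0. indicator (- A) (\<omega> i)) * u (\<omega> 0) \<partial>IT.C 0 (Suc 0) (\<lambda>_. undefined))
      = (\<integral>\<^sup>+\<omega>. indicator (- A) (\<omega> 0) * u (\<omega> 0) \<partial>IT.eP 0 (\<lambda>_. undefined))"
      using bind_return[OF IT.measurable_eP un] by simp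
    also have "\<dots> = (\<integral>\<^sup>+y. indicator (- A) y * u y \<partial>return M x)"
      by (subst IT.nn_integral_eP[OF un]) auto
    also have "\<dots> = indicator (- A) x * u x"
      using x by (intro nn_integral_return) auto
    finally show ?case by simp
  next
    case (Suc n)
    note [measurable] = Suc.prems mA
    let ?C = "IT.C 0 (Suc n) (\<lambda>_. undefined)"
    let ?F = "\<lambda>\<omega>. (\<Prod>i\<le>Suc n. indicator (- A) (\<omega> i)) * u (\<omega> (Suc n))"
    let ?v = "\<lambda>y. \<integral>\<^sup>+z. indicator (- A) z * u z \<partial>h y"
    have sC: "sets ?C = sets (Pi\<^sub>M {0..<Suc n} (\<lambda>_. M))" using IT.sets_C[OF un, of "Suc n"] by simp
    have ePm: "IT.eP (Suc n) \<in> ?C \<rightarrow>\<^sub>M subprob_algebra (Pi\<^sub>M {0..<Suc (Suc n)} (\<lambda>_. M))"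
      unfolding measurable_cong_sets[OF sC refl] by (rule IT.measurable_eP)
    have mF: "?F \<in> borel_measurable (Pi\<^sub>M {0..<Suc (Suc n)} (\<lambda>_. M))"
      by measurable
    have v: "?v \<in> borel_measurable M"
      by (rule measurable_compose[OF kernel_measurable' nn_integral_measurable_subprob_algebra]) measurable
    have "(\<integral>\<^sup>+\<omega>. ?F \<omega> \<partial>IT.C 0 (Suc (Suc n)) (\<lambda>_. undefined)) = (\<integral>\<^sup>+\<omega>. \<integral>\<^sup>+\<omega>'. ?F \<omega>' \<partial>IT.eP (Suc n) \<omega> \<partial>?C)"
      unfolding IT.C.simps(2)[of 0 "Suc n"] add_0 by (rule nn_integral_bind[OF mF ePm])
    also have "\<dots> = (\<integral>\<^sup>+\<omega>. (\<Prod>i\<le>n. indicator (- A) (\<omega> i)) * ?v (\<omega> n) \<partial>?C)"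
    proof (intro nn_integral_cong)
      fix \<omega> assume "\<omega> \<in> space ?C"
      then have \<omega>: "\<omega> \<in> space (Pi\<^sub>M {0..<Suc n} (\<lambda>_. M))"
        using sets_eq_imp_space_eq[OF sC] by simp
      then have \<omega>n: "\<omega> n \<in> space M" by (auto simp: space_PiM PiE_iff)
      have p: "(\<Prod>i\<le>n. indicator (- A) ((fun_upd \<omega> (Suc n) y) i) :: ennreal) = (\<Prod>i\<le>n. indicator (- A) (\<omega> i))" for y
        by (intro prod.cong) auto
      have "(\<integral>\<^sup>+\<omega>'. ?F \<omega>' \<partial>IT.eP (Suc n) \<omega>) = (\<integral>\<^sup>+y. ?F (fun_upd \<omega> (Suc n) y) \<partial>h (\<omega> n))"
        by (subst IT.nn_integral_eP[OF \<omega> mF]) simp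
      also have "\<dots> = (\<integral>\<^sup>+y. (\<Prod>i\<le>n. indicator (- A) (\<omega> i)) * (indicator (- A) y * u y) \<partial>h (\<omega> n))"
        unfolding prod.atMost_Suc p by (simp add: mult.assoc)
      also have "\<dots> = (\<Prod>i\<le>n. indicator (- A) (\<omega> i)) * ?v (\<omega> n)"
        by (rule nn_integral_cmult)
           (unfold measurable_cong_sets[OF sets_kernel'[OF \<omega>n] refl], measurable)
      finally show "(\<integral>\<^sup>+\<omega>'. ?F \<omega>' \<partial>IT.eP (Suc n) \<omega>) = (\<Prod>i\<le>n. indicator (- A) (\<omega> i)) * ?v (\<omega> n)" .
    qed
    also have "\<dots> = navoid A n ?v x" by (rule Suc.IH[OF v])
    finally show ?case by simp
  }
qed

text \<open>The event depends on the first \<open>Suc n\<close> coordinates only. It is a cylinder,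
  and the projective limit gives it the measure of its base under the finite-dimensional
  law.\<close>

lemma emeasure_chain_avoid:
  assumes x: "x \<in> space M" and A [measurable]: "A \<in> sets M"
  shows "emeasure (chain M h x) {\<omega> \<in> space (chain M h x). \<forall>i\<le>n. \<omega> i \<notin> A} = ennreal (avoid A n x)"
proof -
  interpret IT: Ionescu_Tulcea "path_kernel x" "\<lambda>_. M" using x by (rule Ionescu_Tulcea_path)
  have un: "(\<lambda>_. undefined) \<in> space (Pi\<^sub>M {0..<0::nat} (\<lambda>_. M))" by (auto simp: space_PiM)
  let ?J = "{0..<Suc n}"
  let ?X = "{\<omega> \<in> space (Pi\<^sub>M ?J (\<lambda>_. M)). \<forall>i\<le>n. \<omega> i \<notin> A}"
  let ?C = "IT.C 0 (Suc n) (\<lambda>_. undefined)"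
  have X: "?X \<in> sets (Pi\<^sub>M ?J (\<lambda>_. M))"
  proof -
    have "?X = Pi\<^sub>E ?J (\<lambda>_. space M - A)"
      by (auto simp: space_PiM PiE_iff extensional_def)
    then show ?thesis by (auto intro!: sets_PiM_I_finite)
  qed
  have sC: "sets ?C = sets (Pi\<^sub>M ?J (\<lambda>_. M))" using IT.sets_C[OF un, of "Suc n"] by simp
  have ch: "chain M h x = IT.PF.lim" by (simp add: chain_def)
  have "{\<omega> \<in> space (chain M h x). \<forall>i\<le>n. \<omega> i \<notin> A} = IT.PF.emb UNIV ?J ?X"
    unfolding ch by (auto simp: prod_emb_def space_PiM PiE_iff)
  then have "emeasure (chain M h x) {\<omega> \<in> space (chain M h x). \<forall>i\<le>n. \<omega> i \<notin> A} = emeasure (IT.CI ?J) ?X"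
    unfolding ch using IT.lim[OF _ X] by simp
  also have "\<dots> = emeasure ?C (IT.PF.emb ?J ?J ?X)"
    using IT.emeasure_CI[OF subset_refl X] .
  also have "IT.PF.emb ?J ?J ?X = ?X" by (rule prod_emb_id) (auto simp: space_PiM)
  also have "emeasure ?C ?X = (\<integral>\<^sup>+\<omega>. indicator ?X \<omega> \<partial>?C)"
    using X sC by simp
  also have "\<dots> = (\<integral>\<^sup>+\<omega>. (\<Prod>i\<le>n. indicator (- A) (\<omega> i)) * 1 \<partial>?C)"
  proof (intro nn_integral_cong)
    fix \<omega> assume "\<omega> \<in> space ?C"
    then have "\<omega> \<in> space (Pi\<^sub>M ?J (\<lambda>_. M))" using sets_eq_imp_space_eq[OF sC] by simp
    moreover have "(\<Prod>i\<le>n. indicator (- A) (\<omega> i) :: ennreal) = (if \<forall>i\<le>n. \<omega> i \<notin> A then 1 else 0)"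
      by (auto intro!: prod.neutral simp: indicator_def)
    ultimately show "indicator ?X \<omega> = (\<Prod>i\<le>n. indicator (- A) (\<omega> i)) * (1 :: ennreal)"
      by (auto simp: indicator_def)
  qed
  also have "\<dots> = navoid A n (\<lambda>_. 1) x"
    by (rule nn_integral_avoid_path[OF x A]) simp
  finally show ?thesis using navoid_eq_avoid[OF A x] by simp
qed

text \<open>The tail formula: the expectation of an \<open>enat\<close>-valued time is the sum over
  n of the probability that it exceeds n. Time 0 counts as a hit, so exceeding n means avoiding
  \<open>A\<close> at all of 0, ..., n.\<close>

lemma nn_integral_hitting_time:
  assumes x: "x \<in> space M" and A [measurable]: "A \<in> sets M"
  shows "(\<integral>\<^sup>+\<omega>. ennreal_of_enat (hitting_time A \<omega>) \<partial>chain M h x) = (\<Sum>n. ennreal (avoid A n x))"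
proof -
  interpret IT: Ionescu_Tulcea "path_kernel x" "\<lambda>_. M" using x by (rule Ionescu_Tulcea_path)
  have sch: "sets (chain M h x) = sets (Pi\<^sub>M UNIV (\<lambda>_. M))" by (simp add: chain_def)
  \<comment> \<open>Besides evaluating the infimum, this form makes measurability automatic, since
    it is a \<open>LEAST\<close> over measurable conditions.\<close>
  have eq: "hitting_time A \<omega> = (if \<exists>n. \<omega> n \<in> A then enat (LEAST n. \<omega> n \<in> A) else \<infinity>)" for \<omega>
  proof (cases "\<exists>n. \<omega> n \<in> A")
    case True
    then have "\<omega> (LEAST n. \<omega> n \<in> A) \<in> A" by (rule LeastI_ex)
    then have "hitting_time A \<omega> = enat (LEAST n. \<omega> n \<in> A)"
      unfolding hitting_time_def
      by (intro antisym Inf_lower Inf_greatest) (auto intro: Least_le)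
    then show ?thesis using True by simp
  next
    case False
    then have "{enat t | t. \<omega> t \<in> A} = {}" by auto
    then show ?thesis using False unfolding hitting_time_def by (simp add: Inf_enat_def)
  qed
  have less: "enat n < hitting_time A \<omega> \<longleftrightarrow> (\<forall>i\<le>n. \<omega> i \<notin> A)" for n \<omega>
  proof (cases "\<exists>n. \<omega> n \<in> A")
    case True
    then obtain l where l: "hitting_time A \<omega> = enat l" "\<omega> l \<in> A" "\<And>i. \<omega> i \<in> A \<Longrightarrow> l \<le> i"
      using eq[of \<omega>] LeastI_ex[OF True] by (metis Least_le)
    have "n < l \<longleftrightarrow> (\<forall>i\<le>n. \<omega> i \<notin> A)"
      using l(2,3) by (metis le_trans not_le)
    then show ?thesis unfolding l(1) by simp
  next
    case False
    then show ?thesis using eq[of \<omega>] by simp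
  qed
  have meas: "hitting_time A \<in> chain M h x \<rightarrow>\<^sub>M count_space UNIV"
    unfolding measurable_cong_sets[OF sch refl] eq[abs_def] by measurable
  show ?thesis
    unfolding nn_integral_enat_function[OF meas] less emeasure_chain_avoid[OF x A] ..
qed

end

section \<open>Lazy and reversible kernels\<close>

text \<open>\<open>measure_of\<close> returns the intended values only if they form a measure.
  Exhibiting a measure with these values settles this without a check of countable
  additivity.\<close>

lemma measure_of_eqI:
  assumes "sets N = sets M" "\<And>A. A \<in> sets M \<Longrightarrow> F A = emeasure N A"
  shows "measure_of (space M) (sets M) F = N"
proof -
  have "measure_of (space M) (sets M) F = measure_of (space M) (sets M) (emeasure N)"
    using assms(2) by (intro measure_of_eq sets.space_closed) (simp add: sets.sigma_sets_eq)
  also have "\<dots> = N"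
    using measure_of_of_measure[of N] assms(1) sets_eq_imp_space_eq[OF assms(1)] by simp
  finally show ?thesis .
qed

context kernel begin

text \<open>A fair coin decides between moving and staying. In this form, values and integrals of
  the lazy kernel follow from the rules for \<open>bind\<close>.\<close>

lemma lazy_eq_bind:
  assumes x: "x \<in> space M"
  shows "lazy M h x = measure_pmf (bernoulli_pmf (1/2)) \<bind> (\<lambda>b. if b then h x else return M x)"
proof -
  let ?f = "\<lambda>b. if b then h x else return M x"
  have f: "?f \<in> measure_pmf (bernoulli_pmf (1/2)) \<rightarrow>\<^sub>M subprob_algebra M"
    using x by (auto simp: space_subprob_algebra prob_space_imp_subprob_space prob_kernel sets_kernel' prob_space_return)
  show ?thesis
    unfolding lazy_def
  proof (rule measure_of_eqI)
    show "sets (measure_pmf (bernoulli_pmf (1/2)) \<bind> ?f) = sets M"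
      using x by (intro sets_bind) (auto simp: sets_kernel')
    fix A assume A: "A \<in> sets M"
    then have "emeasure (measure_pmf (bernoulli_pmf (1/2)) \<bind> ?f) A =
      (\<integral>\<^sup>+b. emeasure (?f b) A \<partial>measure_pmf (bernoulli_pmf (1/2)))"
      by (intro emeasure_bind[OF _ f]) auto
    also have "\<dots> = ennreal (1/2) * emeasure (h x) A + ennreal (1/2) * indicator A x"
      using A by (simp add: emeasure_return mult.commute)
    finally show "ennreal (1/2) * emeasure (h x) A + ennreal (1/2) * indicator A x =
      emeasure (measure_pmf (bernoulli_pmf (1/2)) \<bind> ?f) A" by simp
  qed
qed

lemma sets_lazy: "x \<in> space M \<Longrightarrow> sets (lazy M h x) = sets M"
  unfolding lazy_eq_bind by (intro sets_bind) (auto simp: sets_kernel')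

lemma emeasure_lazy:
  assumes x: "x \<in> space M" and A: "A \<in> sets M"
  shows "emeasure (lazy M h x) A = ennreal (1/2) * emeasure (h x) A + ennreal (1/2) * indicator A x"
proof -
  let ?f = "\<lambda>b. if b then h x else return M x"
  have "?f \<in> measure_pmf (bernoulli_pmf (1/2)) \<rightarrow>\<^sub>M subprob_algebra M"
    using x by (auto simp: space_subprob_algebra prob_space_imp_subprob_space prob_kernel sets_kernel' prob_space_return)
  then have "emeasure (lazy M h x) A = (\<integral>\<^sup>+b. emeasure (?f b) A \<partial>measure_pmf (bernoulli_pmf (1/2)))"
    unfolding lazy_eq_bind[OF x] using A by (intro emeasure_bind) auto
  then show ?thesis using A by (simp add: emeasure_return mult.commute)
qed

lemma prob_lazy: "x \<in> space M \<Longrightarrow> prob_space (lazy M h x)"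
proof (rule prob_spaceI)
  assume x: "x \<in> space M"
  have "ennreal (1/2 + 1/2) = ennreal (1/2) + ennreal (1/2)" by (rule ennreal_plus) auto
  then show "emeasure (lazy M h x) (space (lazy M h x)) = 1"
    using x emeasure_lazy[OF x sets.top] prob_space.emeasure_space_1[OF prob_kernel[OF x]]
    by (simp add: sets_eq_imp_space_eq[OF sets_lazy[OF x]] space_kernel)
qed

lemma lazy_markov: "markov_kernel M (lazy M h)"
  unfolding markov_kernel_def
proof (intro measurable_prob_algebraI measurable_subprob_algebra)
  fix A assume A [measurable]: "A \<in> sets M"
  have "(\<lambda>x. emeasure (lazy M h x) A) \<in> borel_measurable M \<longleftrightarrow>
    (\<lambda>x. ennreal (1/2) * emeasure (h x) A + ennreal (1/2) * indicator A x) \<in> borel_measurable M"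
    by (intro measurable_cong emeasure_lazy A)
  also have "\<dots>" by measurable
  finally show "(\<lambda>x. emeasure (lazy M h x) A) \<in> borel_measurable M" .
qed (auto simp: prob_lazy sets_lazy prob_space_imp_subprob_space)

lemma kact_lazy:
  assumes bu: "bounded_measurable M u" and x: "x \<in> space M"
  shows "kact (lazy M h) u x = (kact h u x + u x) / 2"
proof -
  from bu obtain B where B: "\<forall>x\<in>space M. \<bar>u x\<bar> \<le> B" unfolding bounded_measurable_def by blast
  let ?p = "measure_pmf (bernoulli_pmf (1/2))"
  let ?f = "\<lambda>b. if b then h x else return M x"
  have "kact (lazy M h) u x = (\<integral>b. (\<integral>y. u y \<partial>?f b) \<partial>?p)"
    unfolding kact_def lazy_eq_bind[OF x]
  proof (rule integral_bind[where K=M and B=B and B'=1])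
    show "?f \<in> ?p \<rightarrow>\<^sub>M subprob_algebra M"
      using x by (auto simp: space_subprob_algebra prob_space_imp_subprob_space prob_kernel sets_kernel' prob_space_return)
    show "AE b in ?p. emeasure (?f b) (space (?f b)) \<le> ennreal 1"
      using x by (intro AE_I2) (auto simp: prob_space.emeasure_space_1 prob_kernel prob_space_return)
    show "finite_measure ?p" by unfold_locales
  qed (use B bu in \<open>auto simp: bounded_measurable_measurable\<close>)
  also have "\<dots> = (kact h u x + u x) / 2"
    using x bu by (simp add: kact_def integral_return bounded_measurable_measurable)
  finally show ?thesis .
qed

end

section \<open>Reversible kernels as self-adjoint operators\<close>

locale rev_kernel = kernel +
  fixes \<pi> :: "'a measure"
  assumes prob_pi': "prob_space \<pi>" and sets_pi' [measurable_cong]: "sets \<pi> = sets M"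
    and rev: "reversible M h \<pi>"
begin

text \<open>Reversibility speaks of pairs of sets. For fixed \<open>B\<close> it is an equality of
  two measures, so the integrals of every \<open>u\<close> agree; for fixed \<open>u\<close> the
  outcome is again an equality of measures, so it extends to every \<open>v\<close>. This replaces
  approximation by simple functions in both arguments.\<close>

lemma nn_integral_self_adjoint:
  fixes u v :: "'a \<Rightarrow> ennreal"
  assumes [measurable]: "u \<in> borel_measurable M" "v \<in> borel_measurable M"
  shows "(\<integral>\<^sup>+x. u x * (\<integral>\<^sup>+y. v y \<partial>h x) \<partial>\<pi>) = (\<integral>\<^sup>+x. (\<integral>\<^sup>+y. u y \<partial>h x) * v x \<partial>\<pi>)"
proof -
  have sp: "space \<pi> = space M" using sets_pi' by (rule sets_eq_imp_space_eq)
  have ne: "space M \<noteq> {}" using prob_space.not_empty[OF prob_pi'] sp by simp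
  have hB [measurable]: "(\<lambda>x. emeasure (h x) B) \<in> borel_measurable M" if "B \<in> sets M" for B
    using that by measurable
  have hu [measurable]: "(\<lambda>x. \<integral>\<^sup>+y. w y \<partial>h x) \<in> borel_measurable M" if "w \<in> borel_measurable M" for w :: "'a \<Rightarrow> ennreal"
    by (rule measurable_compose[OF kernel_measurable' nn_integral_measurable_subprob_algebra[OF that]])
  have hd: "h \<in> density \<pi> w \<rightarrow>\<^sub>M subprob_algebra M" for w
    unfolding measurable_cong_sets[OF trans[OF sets_density sets_pi'] refl] by (rule kernel_measurable')
  have nd: "space (density \<pi> w) \<noteq> {}" for w using ne sp by simp
  have sb: "sets (density \<pi> w \<bind> h) = sets M" for w
    using ne sp by (intro sets_bind) (auto simp: sets_kernel')
  have 1: "density \<pi> (\<lambda>x. emeasure (h x) B) = density \<pi> (indicator B) \<bind> h" if B [measurable]: "B \<in> sets M" for B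
  proof (rule measure_eqI)
    show "sets (density \<pi> (\<lambda>x. emeasure (h x) B)) = sets (density \<pi> (indicator B) \<bind> h)"
      by (simp add: sb sets_pi')
    fix A assume "A \<in> sets (density \<pi> (\<lambda>x. emeasure (h x) B))"
    then have A [measurable]: "A \<in> sets M" by (simp add: sets_pi')
    have "emeasure (density \<pi> (\<lambda>x. emeasure (h x) B)) A = (\<integral>\<^sup>+x\<in>A. emeasure (h x) B \<partial>\<pi>)"
      by (subst emeasure_density) (auto simp: sets_pi')
    also have "\<dots> = (\<integral>\<^sup>+x\<in>B. emeasure (h x) A \<partial>\<pi>)"
      using rev A B unfolding reversible_def by blast
    also have "\<dots> = (\<integral>\<^sup>+x. emeasure (h x) A \<partial>density \<pi> (indicator B))"
      by (subst nn_integral_density) (auto simp: mult.commute sets_pi')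
    also have "\<dots> = emeasure (density \<pi> (indicator B) \<bind> h) A"
      by (rule emeasure_bind[OF nd hd A, symmetric])
    finally show "emeasure (density \<pi> (\<lambda>x. emeasure (h x) B)) A = emeasure (density \<pi> (indicator B) \<bind> h) A" .
  qed
  have 2: "(\<integral>\<^sup>+x. u x * emeasure (h x) B \<partial>\<pi>) = (\<integral>\<^sup>+x\<in>B. (\<integral>\<^sup>+y. u y \<partial>h x) \<partial>\<pi>)" if B [measurable]: "B \<in> sets M" for B
  proof -
    have "(\<integral>\<^sup>+x. u x * emeasure (h x) B \<partial>\<pi>) = (\<integral>\<^sup>+x. u x \<partial>density \<pi> (\<lambda>x. emeasure (h x) B))"
      by (subst nn_integral_density) (auto simp: mult.commute)
    also have "\<dots> = (\<integral>\<^sup>+x. (\<integral>\<^sup>+y. u y \<partial>h x) \<partial>density \<pi> (indicator B))"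
      unfolding 1[OF B] by (rule nn_integral_bind[OF _ hd]) simp
    also have "\<dots> = (\<integral>\<^sup>+x\<in>B. (\<integral>\<^sup>+y. u y \<partial>h x) \<partial>\<pi>)"
      by (subst nn_integral_density) (auto simp: mult.commute)
    finally show ?thesis .
  qed
  have 3: "density \<pi> u \<bind> h = density \<pi> (\<lambda>x. \<integral>\<^sup>+y. u y \<partial>h x)"
  proof (rule measure_eqI)
    show "sets (density \<pi> u \<bind> h) = sets (density \<pi> (\<lambda>x. \<integral>\<^sup>+y. u y \<partial>h x))"
      by (simp add: sb sets_pi')
    fix B assume "B \<in> sets (density \<pi> u \<bind> h)"
    then have B [measurable]: "B \<in> sets M" by (simp add: sb)
    have "emeasure (density \<pi> u \<bind> h) B = (\<integral>\<^sup>+x. emeasure (h x) B \<partial>density \<pi> u)"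
      by (rule emeasure_bind[OF nd hd B])
    also have "\<dots> = (\<integral>\<^sup>+x. u x * emeasure (h x) B \<partial>\<pi>)"
      by (subst nn_integral_density) auto
    also have "\<dots> = emeasure (density \<pi> (\<lambda>x. \<integral>\<^sup>+y. u y \<partial>h x)) B"
      unfolding 2[OF B] by (subst emeasure_density) (auto simp: sets_pi')
    finally show "emeasure (density \<pi> u \<bind> h) B = emeasure (density \<pi> (\<lambda>x. \<integral>\<^sup>+y. u y \<partial>h x)) B" .
  qed
  have "(\<integral>\<^sup>+x. u x * (\<integral>\<^sup>+y. v y \<partial>h x) \<partial>\<pi>) = (\<integral>\<^sup>+x. (\<integral>\<^sup>+y. v y \<partial>h x) \<partial>density \<pi> u)"
    by (subst nn_integral_density) auto
  also have "\<dots> = (\<integral>\<^sup>+x. v x \<partial>(density \<pi> u \<bind> h))"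
    by (rule nn_integral_bind[OF _ hd, symmetric]) simp
  also have "\<dots> = (\<integral>\<^sup>+x. (\<integral>\<^sup>+y. u y \<partial>h x) * v x \<partial>\<pi>)"
    unfolding 3 by (subst nn_integral_density) auto
  finally show ?thesis .
qed

lemma integrable_pi': "bounded_measurable M u \<Longrightarrow> integrable \<pi> u"
  by (rule bounded_measurable_integrable[OF _ prob_pi' sets_pi'])

lemma space_pi': "space \<pi> = space M" using sets_pi' by (rule sets_eq_imp_space_eq)

text \<open>For nonnegative functions this is the \<open>ennreal\<close> identity. A bounded
  function is a difference of a nonnegative function and a nonnegative constant, and the relation
  \<open>S\<close> survives differences; one argument is freed of its sign, then the other by
  symmetry of \<open>S\<close>.\<close>

lemma self_adjoint:
  assumes bu: "bounded_measurable M u" and bv: "bounded_measurable M v"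
  shows "(\<integral>x. u x * kact h v x \<partial>\<pi>) = (\<integral>x. kact h u x * v x \<partial>\<pi>)"
proof -
  define S where "S u v \<longleftrightarrow> (\<integral>x. u x * kact h v x \<partial>\<pi>) = (\<integral>x. kact h u x * v x \<partial>\<pi>)" for u v
  note bm_intros = bounded_measurable_intros kact_bounded_measurable
  have sym: "S u v \<longleftrightarrow> S v u" for u v unfolding S_def by (auto simp: mult.commute)
  have nonneg: "S u v" if b: "bounded_measurable M u" "bounded_measurable M v"
    and p: "\<And>x. x \<in> space M \<Longrightarrow> 0 \<le> u x" "\<And>x. x \<in> space M \<Longrightarrow> 0 \<le> v x" for u v
  proof -
    have k: "(\<integral>\<^sup>+y. ennreal (w y) \<partial>h x) = ennreal (kact h w x)" "0 \<le> kact h w x"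
      if "bounded_measurable M w" "\<And>x. x \<in> space M \<Longrightarrow> 0 \<le> w x" "x \<in> space M" for w x
      unfolding kact_def using that
      by (auto intro!: nn_integral_eq_integral integrable_kernel integral_nonneg_AE simp: space_kernel)
    have eq: "(\<integral>\<^sup>+x. ennreal (u x) * (\<integral>\<^sup>+y. ennreal (v y) \<partial>h x) \<partial>\<pi>) = ennreal (\<integral>x. u x * kact h v x \<partial>\<pi>)
      \<and> 0 \<le> (\<integral>x. u x * kact h v x \<partial>\<pi>)"
      if "bounded_measurable M u" "bounded_measurable M v"
      "\<And>x. x \<in> space M \<Longrightarrow> 0 \<le> u x" "\<And>x. x \<in> space M \<Longrightarrow> 0 \<le> v x" for u v
    proof -
      have "(\<integral>\<^sup>+x. ennreal (u x) * (\<integral>\<^sup>+y. ennreal (v y) \<partial>h x) \<partial>\<pi>) = (\<integral>\<^sup>+x. ennreal (u x * kact h v x) \<partial>\<pi>)"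
        using that by (intro nn_integral_cong) (simp add: space_pi' k ennreal_mult)
      also have "\<dots> = ennreal (\<integral>x. u x * kact h v x \<partial>\<pi>)"
        using that by (intro nn_integral_eq_integral integrable_pi' bm_intros AE_I2 mult_nonneg_nonneg)
          (auto simp: space_pi' k)
      finally show ?thesis
        using that by (auto intro!: integral_nonneg_AE AE_I2 mult_nonneg_nonneg simp: space_pi' k)
    qed
    have "ennreal (\<integral>x. u x * kact h v x \<partial>\<pi>) = ennreal (\<integral>x. v x * kact h u x \<partial>\<pi>)"
      using eq[OF b p] eq[OF b(2,1) p(2,1)] nn_integral_self_adjoint[of "\<lambda>x. ennreal (u x)" "\<lambda>x. ennreal (v x)"] b
      by (simp add: bounded_measurable_measurable mult.commute)
    then show ?thesis
      using eq[OF b p] eq[OF b(2,1) p(2,1)] unfolding S_def by (simp add: mult.commute)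
  qed
  have diff: "S (\<lambda>x. u1 x - u2 x) v"
    if b: "bounded_measurable M u1" "bounded_measurable M u2" "bounded_measurable M v" and S: "S u1 v" "S u2 v" for u1 u2 v
  proof -
    have "(\<integral>x. (u1 x - u2 x) * kact h v x \<partial>\<pi>) = (\<integral>x. u1 x * kact h v x \<partial>\<pi>) - (\<integral>x. u2 x * kact h v x \<partial>\<pi>)"
      unfolding left_diff_distrib using b by (intro Bochner_Integration.integral_diff integrable_pi' bm_intros)
    also have "\<dots> = (\<integral>x. kact h u1 x * v x \<partial>\<pi>) - (\<integral>x. kact h u2 x * v x \<partial>\<pi>)"
      using S unfolding S_def by simp
    also have "\<dots> = (\<integral>x. kact h u1 x * v x - kact h u2 x * v x \<partial>\<pi>)"
      using b by (intro Bochner_Integration.integral_diff[symmetric] integrable_pi' bm_intros)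
    also have "\<dots> = (\<integral>x. kact h (\<lambda>x. u1 x - u2 x) x * v x \<partial>\<pi>)"
      using b by (intro Bochner_Integration.integral_cong) (auto simp: space_pi' kact_diff left_diff_distrib)
    finally show ?thesis unfolding S_def .
  qed
  have half: "S u v" if b: "bounded_measurable M u" "bounded_measurable M v"
    and p: "\<And>x. x \<in> space M \<Longrightarrow> 0 \<le> v x" for u v
  proof -
    from b obtain B where B: "\<forall>x\<in>space M. \<bar>u x\<bar> \<le> B" unfolding bounded_measurable_def by blast
    have "S (\<lambda>x. (u x + \<bar>B\<bar>) - \<bar>B\<bar>) v"
      using b p B by (intro diff nonneg bm_intros) force+
    then show ?thesis by simp
  qed
  from bv obtain B where B: "\<forall>x\<in>space M. \<bar>v x\<bar> \<le> B" unfolding bounded_measurable_def by blast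
  have "S (\<lambda>x. (v x + \<bar>B\<bar>) - \<bar>B\<bar>) u"
    using bu bv B by (intro diff sym[THEN iffD1, OF half] bm_intros) force+
  then have "S v u" by simp
  then have "S u v" by (rule sym[THEN iffD1])
  then show ?thesis unfolding S_def .
qed

text \<open>Self-adjointness tested against the constant 1, which the kernel fixes.\<close>

lemma stationary_pi:
  assumes "bounded_measurable M u"
  shows "(\<integral>x. kact h u x \<partial>\<pi>) = (\<integral>x. u x \<partial>\<pi>)"
proof -
  have "(\<integral>x. u x \<partial>\<pi>) = (\<integral>x. kact h (\<lambda>_. 1) x * u x \<partial>\<pi>)"
    by (intro Bochner_Integration.integral_cong) (auto simp: space_pi' kact_const)
  then show ?thesis using self_adjoint[OF bounded_measurable_const[of M 1] assms] by simp
qed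

text \<open>Jensen's inequality for the square at each state, then stationarity. Jensen comes from
  averaging the square of \<open>w y - ?c\<close>, where \<open>?c\<close> is the mean of
  \<open>w\<close> under \<open>h x\<close>.\<close>

lemma kact_contraction:
  assumes bw: "bounded_measurable M w"
  shows "(\<integral>x. (kact h w x)\<^sup>2 \<partial>\<pi>) \<le> (\<integral>x. (w x)\<^sup>2 \<partial>\<pi>)"
proof -
  note bm_intros = bounded_measurable_intros kact_bounded_measurable
  have "(kact h w x)\<^sup>2 \<le> kact h (\<lambda>y. (w y)\<^sup>2) x" if x: "x \<in> space M" for x
  proof -
    let ?c = "kact h w x"
    have "0 \<le> kact h (\<lambda>y. (w y)\<^sup>2 + (?c\<^sup>2 - 2 * ?c * w y)) x"
    proof (rule order_trans[OF eq_refl kact_mono])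
      show "0 = kact h (\<lambda>_. 0) x" using x by (simp add: kact_const)
      show "0 \<le> (w y)\<^sup>2 + (?c\<^sup>2 - 2 * ?c * w y)" for y
        using zero_le_power2[of "w y - ?c"] by (simp add: power2_eq_square algebra_simps)
    qed (use bw x in \<open>auto intro!: bm_intros\<close>)
    also have "\<dots> = kact h (\<lambda>y. (w y)\<^sup>2) x + (?c\<^sup>2 - 2 * ?c * ?c)"
      using bw x by (simp add: kact_add kact_diff kact_const kact_cmult bm_intros)
    finally show ?thesis by (simp add: power2_eq_square)
  qed
  then have "(\<integral>x. (kact h w x)\<^sup>2 \<partial>\<pi>) \<le> (\<integral>x. kact h (\<lambda>y. (w y)\<^sup>2) x \<partial>\<pi>)"
    using bw by (intro integral_mono integrable_pi' bm_intros) (auto simp: space_pi')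
  then show ?thesis using bw by (simp add: stationary_pi bm_intros)
qed

end

sublocale rev_kernel \<subseteq> stationary_kernel M h \<pi>
  by (intro stationary_kernel.intro stationary_kernel_axioms.intro kernel_axioms prob_pi' sets_pi' stationary_pi)

sublocale rev_kernel \<subseteq> lz: stationary_kernel M "lazy M h" \<pi>
proof (intro stationary_kernel.intro kernel.intro stationary_kernel_axioms.intro lazy_markov prob_pi sets_pi)
  fix u :: "'a \<Rightarrow> real" assume bu: "bounded_measurable M u"
  have "(\<integral>x. kact (lazy M h) u x \<partial>\<pi>) = (\<integral>x. (kact h u x + u x) / 2 \<partial>\<pi>)"
    using bu by (intro Bochner_Integration.integral_cong) (auto simp: space_pi kact_lazy)
  also have "\<dots> = ((\<integral>x. kact h u x \<partial>\<pi>) + (\<integral>x. u x \<partial>\<pi>)) / 2"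
    using bu by (simp add: integrable_pi kact_bounded_measurable)
  finally show "(\<integral>x. kact (lazy M h) u x \<partial>\<pi>) = (\<integral>x. u x \<partial>\<pi>)"
    using bu by (simp add: stationary)
qed

section \<open>Positivity and energy decay of the lazy operator\<close>

context rev_kernel begin

abbreviation Q :: "('a \<Rightarrow> real) \<Rightarrow> 'a \<Rightarrow> real" where
  "Q \<equiv> kact (lazy M h)"

lemmas bm_intros = bounded_measurable_intros kact_bounded_measurable lz.kact_bounded_measurable
  lz.kact_iter_bounded_measurable

lemma Q_self_adjoint:
  assumes bu: "bounded_measurable M u" and bv: "bounded_measurable M v"
  shows "(\<integral>x. u x * Q v x \<partial>\<pi>) = (\<integral>x. Q u x * v x \<partial>\<pi>)"
proof -
  have "(\<integral>x. u x * Q v x \<partial>\<pi>) = (\<integral>x. (u x * kact h v x + u x * v x) / 2 \<partial>\<pi>)"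
    using bv by (intro Bochner_Integration.integral_cong) (auto simp: space_pi kact_lazy algebra_simps)
  also have "\<dots> = ((\<integral>x. u x * kact h v x \<partial>\<pi>) + (\<integral>x. u x * v x \<partial>\<pi>)) / 2"
    using bu bv by (simp add: integrable_pi bm_intros)
  also have "\<dots> = ((\<integral>x. kact h u x * v x \<partial>\<pi>) + (\<integral>x. u x * v x \<partial>\<pi>)) / 2"
    using self_adjoint[OF bu bv] by simp
  also have "\<dots> = (\<integral>x. (kact h u x * v x + u x * v x) / 2 \<partial>\<pi>)"
    using bu bv by (simp add: integrable_pi bm_intros)
  also have "\<dots> = (\<integral>x. Q u x * v x \<partial>\<pi>)"
    using bu by (intro Bochner_Integration.integral_cong) (auto simp: space_pi kact_lazy algebra_simps)
  finally show ?thesis .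
qed

text \<open>Since Q = (I + h)/2, the operator Q(I - Q) equals (I - h^2)/4, and the integral is its
  quadratic form at \<open>w\<close>. Both positivity properties of Q below rest on it.\<close>

lemma contraction_defect:
  assumes bw: "bounded_measurable M w"
  shows "0 \<le> (\<integral>x. ((w x)\<^sup>2 - (kact h w x)\<^sup>2) / 4 \<partial>\<pi>)"
proof -
  have "(\<integral>x. ((w x)\<^sup>2 - (kact h w x)\<^sup>2) / 4 \<partial>\<pi>) = ((\<integral>x. (w x)\<^sup>2 \<partial>\<pi>) - (\<integral>x. (kact h w x)\<^sup>2 \<partial>\<pi>)) / 4"
    using bw by (simp add: integrable_pi bm_intros)
  then show ?thesis using kact_contraction[OF bw] by simp
qed

text \<open>Pointwise, w * Q w is the sum of (Q w)^2 and (w^2 - (h w)^2)/4, and the second term has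
  nonnegative integral. So laziness leaves no negative spectrum.\<close>

lemma Q_nonneg:
  assumes bw: "bounded_measurable M w"
  shows "0 \<le> (\<integral>x. w x * Q w x \<partial>\<pi>)"
proof -
  have "(\<integral>x. ((w x)\<^sup>2 - (kact h w x)\<^sup>2) / 4 \<partial>\<pi>) \<le> (\<integral>x. w x * Q w x \<partial>\<pi>)"
  proof (intro integral_mono)
    fix x assume "x \<in> space \<pi>"
    then have "w x * Q w x = (w x * kact h w x + (w x)\<^sup>2) / 2"
      using bw by (simp add: space_pi kact_lazy power2_eq_square algebra_simps)
    moreover have "0 \<le> (w x + kact h w x)\<^sup>2" by simp
    ultimately show "((w x)\<^sup>2 - (kact h w x)\<^sup>2) / 4 \<le> w x * Q w x"
      by (simp add: power2_eq_square algebra_simps)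
  next
    show "integrable \<pi> (\<lambda>x. ((w x)\<^sup>2 - (kact h w x)\<^sup>2) / 4)"
      using bw by (intro Bochner_Integration.integrable_divide integrable_pi bm_intros)
  qed (use bw in \<open>auto intro!: integrable_pi bm_intros\<close>)
  then show ?thesis using contraction_defect[OF bw] by linarith
qed

text \<open>Positivity of Q - Q^2. As w - Q w = (w - h w)/2, the integrand is a difference of two
  squares divided by 4.\<close>

lemma Q_defect_nonneg:
  assumes bw: "bounded_measurable M w"
  shows "0 \<le> (\<integral>x. Q w x * (w x - Q w x) \<partial>\<pi>)"
proof -
  have "(\<integral>x. Q w x * (w x - Q w x) \<partial>\<pi>) = (\<integral>x. ((w x)\<^sup>2 - (kact h w x)\<^sup>2) / 4 \<partial>\<pi>)"
    using bw by (intro Bochner_Integration.integral_cong)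
      (auto simp: space_pi kact_lazy power2_eq_square field_simps)
  then show ?thesis using contraction_defect[OF bw] by simp
qed

text \<open>The Dirichlet form of the lazy kernel. For the i-th iterate of f it is, spectrally, the
  integral of lambda^(2i) (1 - lambda).\<close>

definition energy :: "('a \<Rightarrow> real) \<Rightarrow> real" where
  "energy w = (\<integral>x. w x * (w x - Q w x) \<partial>\<pi>)"

text \<open>Spectrally 1 - lambda <= 1 - lambda^2, the difference lambda (1 - lambda) being the form
  of Q - Q^2. The right-hand side telescopes along the iterates, which bounds the sum of their
  energies.\<close>

lemma energy_le:
  assumes bw: "bounded_measurable M w"
  shows "energy w \<le> (\<integral>x. (w x)\<^sup>2 \<partial>\<pi>) - (\<integral>x. (Q w x)\<^sup>2 \<partial>\<pi>)"
proof -
  have "(\<integral>x. (w x)\<^sup>2 \<partial>\<pi>) - (\<integral>x. (Q w x)\<^sup>2 \<partial>\<pi>) = (\<integral>x. (w x)\<^sup>2 - (Q w x)\<^sup>2 \<partial>\<pi>)"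
    using bw by (intro Bochner_Integration.integral_diff[symmetric] integrable_pi bm_intros)
  also have "\<dots> = (\<integral>x. w x * (w x - Q w x) + Q w x * (w x - Q w x) \<partial>\<pi>)"
    by (intro Bochner_Integration.integral_cong) (auto simp: power2_eq_square algebra_simps)
  also have "\<dots> = energy w + (\<integral>x. Q w x * (w x - Q w x) \<partial>\<pi>)"
    unfolding energy_def using bw by (intro Bochner_Integration.integral_add integrable_pi bm_intros)
  finally show ?thesis using Q_defect_nonneg[OF bw] by simp
qed

text \<open>The gap between the two sides is the form of Q at z = w - Q w, spectrally lambda (1 -
  lambda)^2. Self-adjointness brings it to this shape, and positivity of Q makes it
  nonnegative.\<close>

lemma energy_drop:
  assumes bw: "bounded_measurable M w"
  shows "(\<integral>x. (Q w x - w x)\<^sup>2 \<partial>\<pi>) \<le> energy w - energy (Q w)"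
proof -
  define z where "z = (\<lambda>x. w x - Q w x)"
  have bz: "bounded_measurable M z" unfolding z_def using bw by (intro bm_intros)
  have Qz: "Q w x - Q (Q w) x = Q z x" if "x \<in> space M" for x
    unfolding z_def using bw that by (simp add: lz.kact_diff bm_intros)
  have 1: "energy w - (\<integral>x. (Q w x - w x)\<^sup>2 \<partial>\<pi>) = (\<integral>x. Q w x * z x \<partial>\<pi>)"
  proof -
    have "energy w - (\<integral>x. (Q w x - w x)\<^sup>2 \<partial>\<pi>) = (\<integral>x. w x * (w x - Q w x) - (Q w x - w x)\<^sup>2 \<partial>\<pi>)"
      unfolding energy_def using bw by (intro Bochner_Integration.integral_diff[symmetric] integrable_pi bm_intros)
    also have "\<dots> = (\<integral>x. Q w x * z x \<partial>\<pi>)"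
      by (intro Bochner_Integration.integral_cong) (auto simp: z_def power2_eq_square algebra_simps)
    finally show ?thesis .
  qed
  have 2: "energy (Q w) = (\<integral>x. Q w x * Q z x \<partial>\<pi>)"
    unfolding energy_def by (intro Bochner_Integration.integral_cong) (auto simp: space_pi Qz)
  have "(\<integral>x. Q w x * z x \<partial>\<pi>) - (\<integral>x. Q w x * Q z x \<partial>\<pi>) = (\<integral>x. w x * Q z x \<partial>\<pi>) - (\<integral>x. Q w x * Q z x \<partial>\<pi>)"
    using Q_self_adjoint[OF bw bz] by simp
  also have "\<dots> = (\<integral>x. w x * Q z x - Q w x * Q z x \<partial>\<pi>)"
    using bw bz by (intro Bochner_Integration.integral_diff[symmetric] integrable_pi bm_intros)
  also have "\<dots> = (\<integral>x. z x * Q z x \<partial>\<pi>)"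
    by (intro Bochner_Integration.integral_cong) (auto simp: z_def algebra_simps)
  finally show ?thesis using Q_nonneg[OF bz] 1 2 by linarith
qed

text \<open>Spectrally 1 - lambda = lambda (1 - lambda) + (1 - lambda)^2, a sum of two nonnegative
  forms.\<close>

lemma energy_nonneg:
  assumes bw: "bounded_measurable M w"
  shows "0 \<le> energy w"
proof -
  have "energy w = (\<integral>x. Q w x * (w x - Q w x) + (w x - Q w x)\<^sup>2 \<partial>\<pi>)"
    unfolding energy_def
    by (intro Bochner_Integration.integral_cong) (auto simp: power2_eq_square algebra_simps)
  also have "\<dots> = (\<integral>x. Q w x * (w x - Q w x) \<partial>\<pi>) + (\<integral>x. (w x - Q w x)\<^sup>2 \<partial>\<pi>)"
    using bw by (intro Bochner_Integration.integral_add integrable_pi bm_intros)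
  finally show ?thesis using Q_defect_nonneg[OF bw] by simp
qed

text \<open>This is where positivity of the lazy kernel enters: the energies of the iterates decrease and
  are summable, so they decay like 1/N, and their decrements control the squared increments.\<close>

lemma sum_increments_le:
  assumes bf: "bounded_measurable M f" and f: "\<And>x. x \<in> space M \<Longrightarrow> \<bar>f x\<bar> \<le> 1"
  shows "(\<Sum>i\<in>{N..<N+n}. \<integral>x. ((Q ^^ Suc i) f x - (Q ^^ i) f x)\<^sup>2 \<partial>\<pi>) \<le> 1 / (N + 1)"
proof -
  define E where "E i = energy ((Q ^^ i) f)" for i
  define a where "a i = (\<integral>x. ((Q ^^ i) f x)\<^sup>2 \<partial>\<pi>)" for i
  have b: "bounded_measurable M ((Q ^^ i) f)" for i using bf by (rule lz.kact_iter_bounded_measurable)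
  have drop: "(\<integral>x. ((Q ^^ Suc i) f x - (Q ^^ i) f x)\<^sup>2 \<partial>\<pi>) \<le> E i - E (Suc i)" for i
    using energy_drop[OF b[of i]] by (simp add: E_def)
  have "E (Suc i) \<le> E i" for i
  proof -
    have "0 \<le> (\<integral>x. ((Q ^^ Suc i) f x - (Q ^^ i) f x)\<^sup>2 \<partial>\<pi>)" by (rule integral_nonneg_AE) auto
    then show ?thesis using drop[of i] by linarith
  qed
  then have dec: "decseq E" by (intro decseq_SucI)
  have "(\<Sum>i\<in>{N..<N+n}. \<integral>x. ((Q ^^ Suc i) f x - (Q ^^ i) f x)\<^sup>2 \<partial>\<pi>) \<le> (\<Sum>i\<in>{N..<N+n}. E i - E (Suc i))"
    by (intro sum_mono drop)
  also have "\<dots> = E N - E (N + n)" by (induction n) auto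
  also have "\<dots> \<le> E N" using energy_nonneg[OF b] by (simp add: E_def)
  also have "E N \<le> 1 / (N + 1)"
  proof -
    have "(N + 1) * E N = (\<Sum>i<N+1. E N)" by simp
    also have "\<dots> \<le> (\<Sum>i<N+1. E i)" using dec by (intro sum_mono) (auto simp: decseq_def)
    also have "\<dots> \<le> (\<Sum>i<N+1. a i - a (Suc i))"
      using energy_le[OF b] by (intro sum_mono) (simp add: E_def a_def)
    also have "\<dots> = a 0 - a (N + 1)" by (rule sum_lessThan_telescope')
    also have "\<dots> \<le> a 0" unfolding a_def by (simp add: integral_nonneg_AE)
    also have "a 0 \<le> (\<integral>x. 1 \<partial>\<pi>)"
      unfolding a_def using bf f
      by (intro integral_mono integrable_pi bm_intros) (auto simp: space_pi abs_square_le_1)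
    also have "\<dots> = 1" by (simp add: pi.prob_space)
    finally show ?thesis by (simp add: field_simps)
  qed
  finally show ?thesis by (simp only: of_nat_add of_nat_1)
qed

end

section \<open>Mixing and hitting times of skeletons\<close>

context kernel begin

lemma kact_iter_uminus: "(kact h ^^ n) (\<lambda>x. - u x) = (\<lambda>x. - (kact h ^^ n) u x)"
  by (induction n) (auto simp: kact_def)

lemma kact_iter_average:
  assumes "bounded_measurable M u" "bounded_measurable M v"
  shows "x \<in> space M \<Longrightarrow>
    (kact h ^^ n) (\<lambda>x. (u x + v x) / 2) x = ((kact h ^^ n) u x + (kact h ^^ n) v x) / 2"
proof (induction n arbitrary: x)
  case (Suc n)
  have "(kact h ^^ Suc n) (\<lambda>x. (u x + v x) / 2) x =
      kact h (\<lambda>x. (1/2) * ((kact h ^^ n) u x + (kact h ^^ n) v x)) x"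
    using Suc by (auto intro: kact_cong)
  also have "\<dots> = (1/2) * (kact h ((kact h ^^ n) u) x + kact h ((kact h ^^ n) v) x)"
    unfolding kact_cmult using Suc.prems assms by (simp only: kact_add kact_iter_bounded_measurable)
  finally show ?case by simp
qed simp

lemma kact_iter_steps:
  assumes bu: "bounded_measurable M u"
  shows "x \<in> space M \<Longrightarrow> (kact (steps M h k) ^^ j) u x = (kact h ^^ (k * j)) u x"
proof (induction j arbitrary: x)
  case (Suc j)
  interpret S: kernel M "steps M h k" by unfold_locales (rule steps_markov)
  have "(kact (steps M h k) ^^ Suc j) u x = kact (steps M h k) ((kact h ^^ (k * j)) u) x"
    using Suc by (auto intro: S.kact_cong)
  also have "\<dots> = (kact h ^^ k) ((kact h ^^ (k * j)) u) x"
    using Suc bu by (intro kact_steps kact_iter_bounded_measurable)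
  finally show ?case by (simp add: funpow_add)
qed simp

text \<open>The strong Markov property at the hitting time of D, in the form of an induction on the
  number of remaining steps.\<close>

lemma kact_iter_ge_avoid:
  assumes bf: "bounded_measurable M f" and f: "\<And>x. x \<in> space M \<Longrightarrow> a - 1 \<le> f x"
    and D: "D \<in> sets M" and aD: "\<And>j y. j \<le> t \<Longrightarrow> y \<in> D \<Longrightarrow> a \<le> (kact h ^^ j) f y"
    and "x \<in> space M" "j \<le> t"
  shows "a - avoid D j x \<le> (kact h ^^ j) f x"
  using assms(5,6)
proof (induction j arbitrary: x)
  case 0
  then show ?case using aD[of 0 x] f[of x] by (cases "x \<in> D") auto
next
  case (Suc j)
  show ?case
  proof (cases "x \<in> D")
    case True
    then show ?thesis using aD[OF Suc.prems(2) True] by simp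
  next
    case False
    have "a - kact h (avoid D j) x = kact h (\<lambda>y. a - avoid D j y) x"
      using Suc.prems D by (simp add: kact_diff kact_const avoid_bounded_measurable)
    also have "\<dots> \<le> kact h ((kact h ^^ j) f) x"
      using Suc D bf
      by (intro kact_mono bounded_measurable_diff bounded_measurable_const avoid_bounded_measurable
          kact_iter_bounded_measurable) auto
    finally show ?thesis using False by simp
  qed
qed

text \<open>Each lazy step averages the deviation at times j and j + 1, whence the factor 3/4 on the
  term that is geometric in j.\<close>

lemma kact_lazy_iter_deviation:
  assumes bf: "bounded_measurable M f"
    and 1: "\<And>j x. x \<in> space M \<Longrightarrow> \<bar>(kact h ^^ j) f x - c\<bar> \<le> 1"
    and L: "\<And>j x. L \<le> j \<Longrightarrow> x \<in> space M \<Longrightarrow> \<bar>(kact h ^^ j) f x - c\<bar> \<le> 1/8"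
  shows "x \<in> space M \<Longrightarrow>
    \<bar>(kact (lazy M h) ^^ n) ((kact h ^^ j) f) x - c\<bar> \<le> 1/8 + 2^L / 2^j * (3/4)^n"
proof (induction n arbitrary: x j)
  case 0
  show ?case
  proof (cases "L \<le> j")
    case True
    have "(0::real) \<le> 2^L / 2^j * (3/4)^0" by simp
    then show ?thesis using L[OF True 0] by (simp only: funpow_0)
  next
    case False
    then have "(2::real)^j \<le> 2^L" by (intro power_increasing) auto
    then have "(1::real) \<le> 2^L / 2^j" by simp
    then show ?thesis using 1[OF 0, of j] unfolding funpow_0 power_0 mult_1_right by linarith
  qed
next
  case (Suc n)
  interpret G: kernel M "lazy M h" by unfold_locales (rule lazy_markov)
  have b: "bounded_measurable M ((kact h ^^ i) f)" for i
    using bf by (rule kact_iter_bounded_measurable)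
  have "(kact (lazy M h) ^^ Suc n) ((kact h ^^ j) f) x =
      (kact (lazy M h) ^^ n) (kact (lazy M h) ((kact h ^^ j) f)) x"
    by (simp only: funpow_Suc_right comp_apply)
  also have "\<dots> = (kact (lazy M h) ^^ n) (\<lambda>x. ((kact h ^^ Suc j) f x + (kact h ^^ j) f x) / 2) x"
    using Suc.prems b by (intro G.kact_iter_cong) (auto simp: kact_lazy)
  also have "\<dots> = ((kact (lazy M h) ^^ n) ((kact h ^^ Suc j) f) x + (kact (lazy M h) ^^ n) ((kact h ^^ j) f) x) / 2"
    by (rule G.kact_iter_average[OF b b Suc.prems])
  finally have eq: "(kact (lazy M h) ^^ Suc n) ((kact h ^^ j) f) x - c =
    (((kact (lazy M h) ^^ n) ((kact h ^^ Suc j) f) x - c) + ((kact (lazy M h) ^^ n) ((kact h ^^ j) f) x - c)) / 2"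
    by (simp add: field_simps)
  have "2^L / 2^Suc j * (3/4)^n + 2^L / 2^j * (3/4)^n = 2 * (2^L / 2^j * (3/4)^Suc n :: real)"
    by (simp add: field_simps)
  moreover have "\<bar>(a + b) / 2\<bar> \<le> 1/8 + z"
    if "\<bar>a\<bar> \<le> 1/8 + p" "\<bar>b\<bar> \<le> 1/8 + q" "p + q = 2 * z" for a b p q z :: real
  proof -
    have "\<bar>a + b\<bar> \<le> 2 * (1/8 + z)" using that abs_triangle_ineq[of a b] by simp
    then show ?thesis by (simp add: abs_divide)
  qed
  ultimately show ?case
    unfolding eq using Suc.IH[OF Suc.prems] by blast
qed

text \<open>Among \<open>10 * L\<close> lazy steps, fewer than \<open>L\<close> are real moves only
  with small probability. The geometric term is at most (2 * (3/4)^10)^L, and 2 * (3/4)^10 < 1/8;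
  with the 1/8 left over from \<open>L\<close> real moves this makes 1/4.\<close>

lemma mixing_time_lazy_le:
  assumes pi: "prob_space \<pi>" and ne: "space M \<noteq> {}" and L1: "1 \<le> L"
    and L: "\<And>A j x. A \<in> sets M \<Longrightarrow> L \<le> j \<Longrightarrow> x \<in> space M \<Longrightarrow>
      \<bar>(kact h ^^ j) (indicator A) x - measure \<pi> A\<bar> \<le> 1/8"
  shows "mixing_time M (lazy M h) \<pi> \<le> enat (10 * L)"
proof -
  interpret G: kernel M "lazy M h" by unfold_locales (rule lazy_markov)
  show ?thesis
  proof (rule G.mixing_time_leI[OF ne])
    fix x A assume x: "x \<in> space M" and A: "A \<in> sets M"
    have b: "bounded_measurable M (indicator A)" using A by simp
    have one: "\<bar>(kact h ^^ j) (indicator A) y - measure \<pi> A\<bar> \<le> 1" if "y \<in> space M" for j y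
    proof -
      have "0 \<le> (kact h ^^ j) (indicator A) y \<and> (kact h ^^ j) (indicator A) y \<le> 1"
        by (rule kact_iter_bounds[OF b _ that]) (auto simp: indicator_def)
      then show ?thesis
        using prob_space.prob_le_1[OF pi, of A] measure_nonneg[of \<pi> A] by linarith
    qed
    have "\<bar>(kact (lazy M h) ^^ (10 * L)) ((kact h ^^ 0) (indicator A)) x - measure \<pi> A\<bar>
        \<le> 1/8 + 2^L / 2^0 * (3/4)^(10 * L)"
      using one L[OF A] x by (intro kact_lazy_iter_deviation[OF b])
    also have "(2::real)^L / 2^0 * (3/4)^(10 * L) = (2 * (3/4)^10)^L"
      by (simp only: power_mult_distrib power_mult) simp
    also have "\<dots> \<le> (1/8)^L" by (intro power_mono) (auto simp: power_divide)
    also have "\<dots> \<le> (1/8)^1" using L1 by (intro power_decreasing) auto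
    finally show "\<bar>measure (steps M (lazy M h) (10 * L) x) A - measure \<pi> A\<bar> \<le> 1/4"
      using G.measure_steps[OF A x] by simp
  qed
qed

end

text \<open>The supremum of the levels that \<open>u\<close> reaches with probability at least 1/2.
  The slack \<open>e\<close> on both sides avoids having to show that the supremum is
  attained.\<close>

lemma (in prob_space) median_exists:
  assumes [measurable]: "u \<in> borel_measurable M" and u: "\<And>x. x \<in> space M \<Longrightarrow> 0 \<le> u x \<and> u x \<le> (1::real)"
    and "0 < e"
  obtains m where "0 \<le> m" "m \<le> 1" "1/2 \<le> prob {x \<in> space M. m - e \<le> u x}"
    "1/2 \<le> prob {x \<in> space M. u x \<le> m + e}"
proof -
  define S where "S = {m. 1/2 \<le> prob {x \<in> space M. m \<le> u x}}"
  have "{x \<in> space M. 0 \<le> u x} = space M" using u by auto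
  then have S0: "0 \<in> S" by (simp add: S_def prob_space)
  have S1: "m \<le> 1" if "m \<in> S" for m
  proof (rule ccontr)
    assume "\<not> m \<le> 1"
    then have "{x \<in> space M. m \<le> u x} = {}" using u by force
    then show False using that by (simp only: S_def mem_Collect_eq) simp
  qed
  then have bdd: "bdd_above S" by (intro bdd_aboveI)
  show ?thesis
  proof
    show "0 \<le> Sup S" using cSup_upper[OF S0 bdd] .
    show "Sup S \<le> 1" using S0 S1 by (intro cSup_least) auto
    obtain m where m: "m \<in> S" "Sup S - e < m"
      using less_cSup_iff[OF _ bdd, of "Sup S - e"] S0 \<open>0 < e\<close> by force
    then have "prob {x \<in> space M. m \<le> u x} \<le> prob {x \<in> space M. Sup S - e \<le> u x}"
      by (intro finite_measure_mono) auto
    then show "1/2 \<le> prob {x \<in> space M. Sup S - e \<le> u x}" using m by (simp add: S_def)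
    have "Sup S + e \<notin> S"
      using cSup_upper[OF _ bdd, of "Sup S + e"] \<open>0 < e\<close> by linarith
    then have "prob {x \<in> space M. Sup S + e \<le> u x} < 1/2" by (simp add: S_def)
    moreover have "prob (space M - {x \<in> space M. Sup S + e \<le> u x}) = 1 - prob {x \<in> space M. Sup S + e \<le> u x}"
      by (rule prob_compl) measurable
    moreover have "prob (space M - {x \<in> space M. Sup S + e \<le> u x}) \<le> prob {x \<in> space M. u x \<le> Sup S + e}"
      by (intro finite_measure_mono) auto
    ultimately show "1/2 \<le> prob {x \<in> space M. u x \<le> Sup S + e}" by linarith
  qed
qed

section \<open>Oscillation off a small set, and convergence of the skeleton\<close>

context rev_kernel begin

text \<open>A maximal inequality. By Cauchy-Schwarz the square of each change over at most
  \<open>n\<close> steps is below \<open>F\<close>, which does not depend on \<open>j\<close>; a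
  single use of Markov's inequality on \<open>F\<close> thus serves all \<open>j\<close> at once.
  The mean of \<open>F\<close> is \<open>n\<close> times the sum of squared increments.\<close>

lemma oscillation_exceptional_set:
  fixes n N :: nat
  assumes bf: "bounded_measurable M f" and f: "\<And>x. x \<in> space M \<Longrightarrow> \<bar>f x\<bar> \<le> 1" and "0 < e"
  obtains B where "B \<in> sets M" "measure \<pi> B \<le> n / ((real N + 1) * e\<^sup>2)"
    "\<And>x j. x \<in> space M \<Longrightarrow> x \<notin> B \<Longrightarrow> j \<le> n \<Longrightarrow> \<bar>(Q ^^ (N + j)) f x - (Q ^^ N) f x\<bar> \<le> e"
proof -
  define d where "d i x = (Q ^^ Suc i) f x - (Q ^^ i) f x" for i x
  define F where "F x = real n * (\<Sum>i\<in>{N..<N+n}. (d i x)\<^sup>2)" for x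
  have bd: "bounded_measurable M (\<lambda>x. (d i x)\<^sup>2)" for i
    unfolding d_def using bf by (intro bounded_measurable_power2 bounded_measurable_diff lz.kact_iter_bounded_measurable)
  have bF: "bounded_measurable M F"
    unfolding F_def[abs_def] by (intro bounded_measurable_mult bounded_measurable_sum bounded_measurable_const bd)
  have mF [measurable]: "F \<in> borel_measurable M" using bF by (rule bounded_measurable_measurable)
  let ?B = "{x \<in> space M. e\<^sup>2 \<le> F x}"
  have "(\<integral>x. F x \<partial>\<pi>) = n * (\<Sum>i\<in>{N..<N+n}. \<integral>x. (d i x)\<^sup>2 \<partial>\<pi>)"
    unfolding F_def using integrable_pi[OF bd] by (simp add: Bochner_Integration.integral_sum)
  also have "\<dots> \<le> n * (1 / (real N + 1))"
    using sum_increments_le[OF bf f, of N n] unfolding d_def by (intro mult_left_mono) auto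
  finally have IF: "(\<integral>x. F x \<partial>\<pi>) \<le> n / (real N + 1)" by simp
  have F0: "0 \<le> F x" for x unfolding F_def by (intro mult_nonneg_nonneg sum_nonneg) auto
  have "measure \<pi> {x \<in> space \<pi>. e\<^sup>2 \<le> F x} \<le> (\<integral>x. F x \<partial>\<pi>) / e\<^sup>2"
    using \<open>0 < e\<close> bF F0
    by (intro integral_Markov_inequality_measure[where A="{}"] integrable_pi) auto
  also have "\<dots> \<le> n / (real N + 1) / e\<^sup>2" using IF \<open>0 < e\<close> by (intro divide_right_mono) auto
  finally have mB: "measure \<pi> ?B \<le> n / ((real N + 1) * e\<^sup>2)" by (simp add: space_pi)
  show ?thesis
  proof
    show "?B \<in> sets M" by measurable
    show "measure \<pi> ?B \<le> n / ((real N + 1) * e\<^sup>2)" by (rule mB)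
    fix x j assume x: "x \<in> space M" "x \<notin> ?B" and j: "j \<le> n"
    have "((Q ^^ (N + j)) f x - (Q ^^ N) f x)\<^sup>2 = (\<Sum>i\<in>{N..<N+j}. d i x * 1)\<^sup>2"
      using sum_Suc_diff'[of N "N + j" "\<lambda>i. (Q ^^ i) f x"] by (simp add: d_def)
    also have "\<dots> \<le> (\<Sum>i\<in>{N..<N+j}. (d i x)\<^sup>2) * (\<Sum>i\<in>{N..<N+j}. 1\<^sup>2)"
      by (rule Cauchy_Schwarz_ineq_sum)
    also have "\<dots> = j * (\<Sum>i\<in>{N..<N+j}. (d i x)\<^sup>2)" by simp
    also have "\<dots> \<le> F x"
      unfolding F_def using j by (intro mult_mono sum_mono2 sum_nonneg) auto
    also have "\<dots> \<le> e\<^sup>2" using x by auto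
    finally show "\<bar>(Q ^^ (N + j)) f x - (Q ^^ N) f x\<bar> \<le> e"
      using \<open>0 < e\<close> by (metis abs_le_square_iff abs_of_pos)
  qed
qed

text \<open>\<open>s\<close> is the waiting time and \<open>t\<close> the window, both counted in
  steps of the skeleton. The constant 4096 is 1/e^2 for the tolerance e = 1/64: it makes the
  exceptional set \<open>B\<close> of measure at most \<open>1/2 - \<alpha>\<close>, so a set of
  measure at least 1/2 keeps measure at least \<open>\<alpha>\<close> when \<open>B\<close> is
  removed.\<close>

lemma skeleton_deviation_le:
  assumes A: "A \<in> sets M" and "k > 0" "t > 0"
    and s: "4096 * real t \<le> (1/2 - \<alpha>) * real s"
    and avoid: "\<And>D x. D \<in> sets M \<Longrightarrow> \<alpha> \<le> measure \<pi> D \<Longrightarrow> x \<in> space M \<Longrightarrow>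
      kernel.avoid (steps M (lazy M h) k) D t x \<le> 1/32"
    and x: "x \<in> space M"
  shows "\<bar>(kact (steps M (lazy M h) k) ^^ (s + t)) (indicator A) x - measure \<pi> A\<bar> \<le> 1/8"
proof -
  define P where "P = steps M (lazy M h) k"
  interpret P: kernel M P unfolding P_def by unfold_locales (rule lz.steps_markov)
  define f where "f = (indicator A :: 'a \<Rightarrow> real)"
  have bf: "bounded_measurable M f" using A by (simp add: f_def)
  have f01: "0 \<le> f x \<and> f x \<le> 1" for x by (auto simp: f_def indicator_def)
  define e :: real where "e = 1/64" \<comment> \<open>the budget is \<open>1/8 = 2 * (2 * e + 1/32)\<close>\<close>
  have PQ: "(kact P ^^ j) f y = (Q ^^ (k * j)) f y" if "y \<in> space M" for j y
    unfolding P_def using lz.kact_iter_steps[OF bf that] .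
  define u where "u = (Q ^^ (k * s)) f"
  have bu: "bounded_measurable M u" unfolding u_def using bf by (rule lz.kact_iter_bounded_measurable)
  have mu [measurable]: "u \<in> borel_measurable M" using bu by (rule bounded_measurable_measurable)
  have u01: "0 \<le> u y \<and> u y \<le> 1" if "y \<in> space M" for y
    unfolding u_def using lz.kact_iter_bounds[OF bf f01 that] by simp
  obtain B where B [measurable]: "B \<in> sets M" and mB: "measure \<pi> B \<le> real (k * t) / ((real (k * s) + 1) * e\<^sup>2)"
    and osc: "\<And>y j. y \<in> space M \<Longrightarrow> y \<notin> B \<Longrightarrow> j \<le> k * t \<Longrightarrow> \<bar>(Q ^^ (k * s + j)) f y - (Q ^^ (k * s)) f y\<bar> \<le> e"
  proof (rule oscillation_exceptional_set[OF bf, where e=e and n="k * t" and N="k * s"])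
    show "\<bar>f y\<bar> \<le> 1" for y using f01[of y] by auto
    show "0 < e" by (simp add: e_def)
  qed (rule that)
  have "4096 * real (k * t) \<le> (1/2 - \<alpha>) * (real (k * s) + 1)"
  proof -
    have "4096 * real t * real k \<le> (1/2 - \<alpha>) * real s * real k"
      using s by (intro mult_right_mono) auto
    moreover have "0 < (1/2 - \<alpha>) * real s" using s \<open>t > 0\<close> by (smt (verit) of_nat_0_less_iff)
    then have "0 < 1/2 - \<alpha>" by (simp add: zero_less_mult_iff)
    ultimately show ?thesis by (simp add: algebra_simps)
  qed
  moreover have e2: "e\<^sup>2 = 1/4096" by (simp add: e_def power2_eq_square)
  ultimately have "real (k * t) \<le> (1/2 - \<alpha>) * ((real (k * s) + 1) * e\<^sup>2)"
    unfolding e2 mult.assoc[symmetric] by linarith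
  moreover have "0 < (real (k * s) + 1) * e\<^sup>2"
    unfolding e2 by (intro mult_pos_pos add_nonneg_pos) auto
  ultimately have "real (k * t) / ((real (k * s) + 1) * e\<^sup>2) \<le> 1/2 - \<alpha>"
    by (simp only: pos_divide_le_eq)
  with mB have mB': "measure \<pi> B \<le> 1/2 - \<alpha>" by linarith
  have big: "\<alpha> \<le> measure \<pi> (E - B)" if "E \<in> sets M" "1/2 \<le> measure \<pi> E" for E
  proof -
    have "measure \<pi> E \<le> measure \<pi> ((E - B) \<union> B)"
      using that B by (intro pi.finite_measure_mono) (auto simp: sets_pi)
    also have "\<dots> \<le> measure \<pi> (E - B) + measure \<pi> B"
      using that B by (intro measure_Un_le) (auto simp: sets_pi)
    finally show ?thesis using mB' that by linarith
  qed
  obtain m where m: "0 \<le> m" "m \<le> 1" "1/2 \<le> measure \<pi> {x \<in> space \<pi>. m - e \<le> u x}"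
    "1/2 \<le> measure \<pi> {x \<in> space \<pi>. u x \<le> m + e}"
  proof (rule pi.median_exists[of u e])
    show "u \<in> borel_measurable \<pi>" by measurable
    show "0 < e" by (simp add: e_def)
  qed (use u01 in \<open>auto simp: space_pi\<close>)
  define D1 where "D1 = {x \<in> space M. m - e \<le> u x} - B"
  define D2 where "D2 = {x \<in> space M. u x \<le> m + e} - B"
  have D [measurable]: "D1 \<in> sets M" "D2 \<in> sets M" unfolding D1_def D2_def by measurable
  have D\<alpha>: "\<alpha> \<le> measure \<pi> D1" "\<alpha> \<le> measure \<pi> D2"
    unfolding D1_def D2_def using m(3,4) by (auto intro!: big simp: space_pi)
  \<comment> \<open>On \<open>space M\<close> this agrees with \<open>u\<close>. The Markov argument
    needs it as an iterate of \<open>P\<close>, the oscillation bound as an iterate of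
    \<open>Q\<close>.\<close>
  define w where "w = (kact P ^^ s) f"
  have bw: "bounded_measurable M w" unfolding w_def using bf by (rule P.kact_iter_bounded_measurable)
  have wj: "(kact P ^^ j) w y = (Q ^^ (k * s + k * j)) f y" if "y \<in> space M" for j y
  proof -
    have "(kact P ^^ j) w y = (kact P ^^ (s + j)) f y"
      unfolding w_def add.commute[of s j] by (simp add: funpow_add)
    then show ?thesis using PQ[OF that] by (simp add: distrib_left)
  qed
  have w01: "0 \<le> w y \<and> w y \<le> 1" if "y \<in> space M" for y
    unfolding w_def using P.kact_iter_bounds[OF bf f01 that] by simp
  have near: "\<bar>(kact P ^^ j) w y - u y\<bar> \<le> e" if "y \<in> space M" "y \<notin> B" "j \<le> t" for j y
    using osc[OF that(1,2), of "k * j"] that by (simp add: wj u_def)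
  \<comment> \<open>One \<open>e\<close> is lost in the median and one in the oscillation between
    hitting \<open>D1\<close> and the deadline; paths that miss \<open>D1\<close> lose at most
    1.\<close>
  have lower: "m - 2 * e - P.avoid D1 t y \<le> (kact P ^^ t) w y" if "y \<in> space M" for y
  proof (rule P.kact_iter_ge_avoid[OF bw _ D(1)])
    fix j z assume "j \<le> t" "z \<in> D1"
    then show "m - 2 * e \<le> (kact P ^^ j) w z"
      using near[of z j] unfolding D1_def by (auto simp: abs_le_iff)
  qed (use that w01 m in \<open>auto simp: e_def intro: order_trans[of _ 0]\<close>)
  \<comment> \<open>The same argument for \<open>- w\<close>, whose large values are the small
    values of \<open>w\<close>.\<close>
  have upper: "- (m + 2 * e) - P.avoid D2 t y \<le> (kact P ^^ t) (\<lambda>x. - w x) y" if "y \<in> space M" for y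
  proof (rule P.kact_iter_ge_avoid[OF bounded_measurable_minus[OF bw] _ D(2)])
    fix j z assume "j \<le> t" "z \<in> D2"
    then show "- (m + 2 * e) \<le> (kact P ^^ j) (\<lambda>x. - w x) z"
      using near[of z j] unfolding D2_def P.kact_iter_uminus by (auto simp: abs_le_iff)
  next
    show "- (m + 2 * e) - 1 \<le> - w z" if "z \<in> space M" for z
      using w01[OF that] m by (simp add: e_def)
  qed (use that in auto)
  have dev: "m - 1/16 \<le> (kact P ^^ t) w y \<and> (kact P ^^ t) w y \<le> m + 1/16" if "y \<in> space M" for y
  proof -
    have "- (m + 2 * e) - P.avoid D2 t y \<le> - (kact P ^^ t) w y"
      using upper[OF that] unfolding P.kact_iter_uminus .
    with lower[OF that] avoid[folded P_def, OF D(1) D\<alpha>(1) that] avoid[folded P_def, OF D(2) D\<alpha>(2) that]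
    show ?thesis unfolding e_def by (intro conjI) linarith+
  qed
  have bPw: "bounded_measurable M ((kact P ^^ t) w)" using bw by (rule P.kact_iter_bounded_measurable)
  \<comment> \<open>So far only closeness to the median \<open>m\<close> is known. The iterate has
    mean \<open>measure \<pi> A\<close> by stationarity and lies within 1/16 of \<open>m\<close>
    everywhere, so \<open>m\<close> is within 1/16 of that mean.\<close>
  have "(\<integral>y. (kact P ^^ t) w y \<partial>\<pi>) = (\<integral>y. (Q ^^ (k * s + k * t)) f y \<partial>\<pi>)"
    by (intro Bochner_Integration.integral_cong) (auto simp: wj space_pi)
  also have "\<dots> = (\<integral>y. f y \<partial>\<pi>)" using bf by (rule lz.stationary_iter)
  also have "\<dots> = measure \<pi> A" using A by (simp add: f_def sets_pi)
  finally have I: "(\<integral>y. (kact P ^^ t) w y \<partial>\<pi>) = measure \<pi> A" .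
  have "(\<integral>y. m - 1/16 \<partial>\<pi>) \<le> (\<integral>y. (kact P ^^ t) w y \<partial>\<pi>)" "(\<integral>y. (kact P ^^ t) w y \<partial>\<pi>) \<le> (\<integral>y. m + 1/16 \<partial>\<pi>)"
    by (intro integral_mono integrable_pi bPw bounded_measurable_const; use dev in \<open>simp add: space_pi\<close>)+
  then have "m - 1/16 \<le> measure \<pi> A" "measure \<pi> A \<le> m + 1/16"
    unfolding I by (simp_all add: pi.prob_space)
  moreover have "(kact P ^^ (s + t)) f x = (kact P ^^ t) w x"
    unfolding w_def add.commute[of s t] by (simp add: funpow_add)
  ultimately show ?thesis using dev[OF x] unfolding P_def[symmetric] f_def[symmetric] by linarith
qed

end

section \<open>The two inequalities for the skeleton\<close>

context rev_kernel begin

text \<open>After \<open>n\<close> mixing times of the lazy kernel a set of measure at least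
  \<open>\<alpha>\<close> is occupied with probability at least \<open>\<alpha> / 2\<close> from
  every state. Repeated trials give an expected time of at most the trial length divided by this
  probability.\<close>

lemma max_hitting_time_skeleton_le:
  assumes "0 < \<alpha>" "0 < k" and n: "(1/2)^n \<le> \<alpha> / 2"
  shows "max_hitting_time M (skeleton M k (lazy M h)) \<pi> \<alpha> \<le>
    ennreal (2 / \<alpha> * (real n + 1)) * (1 + ennreal_of_enat (mixing_time M (lazy M h) \<pi>) / of_nat k)"
proof (cases "mixing_time M (lazy M h) \<pi>")
  case infinity
  \<comment> \<open>With infinite mixing time the right-hand side is infinite.\<close>
  have "(\<top>::ennreal) / of_nat k = \<top>"
    by (simp add: ennreal_top_divide)
  then show ?thesis using infinity \<open>0 < \<alpha>\<close> by (simp add: ennreal_mult_top)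
next
  case (enat tl)
  interpret P: kernel M "skeleton M k (lazy M h)"
    unfolding skeleton_def by unfold_locales (rule lz.steps_markov)
  \<comment> \<open>One trial in skeleton steps: the added 1 makes \<open>k * s\<close> at least
    \<open>n * tl\<close>, and it is the source of the summand 1 in the bound.\<close>
  define s where "s = n * tl div k + 1"
  have "n * tl \<le> k * s"
    unfolding s_def using \<open>0 < k\<close>
    by (metis Suc_eq_plus1 dividend_less_times_div less_imp_le mult_Suc_right add.commute)
  have "real (n * tl div k) \<le> real (n * tl) / real k" by (rule of_nat_div_le_of_nat)
  then have s_le: "real s \<le> (real n + 1) * (1 + real tl / real k)"
  proof -
    define z where "z = real tl / real k"
    have "0 \<le> z" by (simp add: z_def)
    then have "real n * z + 1 \<le> (real n + 1) * (1 + z)" by (simp add: algebra_simps)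
    then show ?thesis
      using \<open>real (n * tl div k) \<le> real (n * tl) / real k\<close> by (simp add: s_def z_def)
  qed
  have bound: "(\<integral>\<^sup>+\<omega>. ennreal_of_enat (hitting_time A \<omega>) \<partial>chain M (skeleton M k (lazy M h)) x)
    \<le> ennreal (real s / (\<alpha> / 2))" if x: "x \<in> space M" and A: "A \<in> sets M" "\<alpha> \<le> measure \<pi> A" for x A
  proof -
    have bA: "bounded_measurable M (indicator A)" using A by simp
    have hit: "\<alpha> / 2 \<le> (kact (skeleton M k (lazy M h)) ^^ s) (indicator A) y" if y: "y \<in> space M" for y
      using lz.kact_iter_steps[OF bA y, where k=k and j=s]
        lz.kact_iter_indicator_deviation[OF enat A(1) y \<open>n * tl \<le> k * s\<close>] n A(2)
      unfolding skeleton_def by (simp add: abs_le_iff)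
    have "\<alpha> / 2 \<le> 1" using A(2) pi.prob_le_1[of A] \<open>0 < \<alpha>\<close> by linarith
    then have "(\<Sum>n<N. P.avoid A n x) \<le> real s / (\<alpha> / 2)" for N
      using \<open>0 < \<alpha>\<close> by (intro P.sum_avoid_le[OF A(1) _ _ x hit]) auto
    then have "(\<Sum>n<N. ennreal (P.avoid A n x)) \<le> ennreal (real s / (\<alpha> / 2))" for N
      using P.avoid_bounds[OF A(1) x] by (subst sum_ennreal) (auto intro: ennreal_leI)
    then show ?thesis
      unfolding P.nn_integral_hitting_time[OF x A(1)] by (intro suminf_le_const) auto
  qed
  have "max_hitting_time M (skeleton M k (lazy M h)) \<pi> \<alpha> \<le> ennreal (real s / (\<alpha> / 2))"
    unfolding max_hitting_time_def using bound by (intro Sup_least) auto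
  also have "\<dots> \<le> ennreal (2 / \<alpha> * (real n + 1) * (1 + real tl / real k))"
  proof (intro ennreal_leI)
    have "2 / \<alpha> * real s \<le> 2 / \<alpha> * ((real n + 1) * (1 + real tl / real k))"
      using s_le \<open>0 < \<alpha>\<close> by (intro mult_left_mono) auto
    moreover have "real s / (\<alpha> / 2) = 2 / \<alpha> * real s" by simp
    ultimately show "real s / (\<alpha> / 2) \<le> 2 / \<alpha> * (real n + 1) * (1 + real tl / real k)"
      by (simp only: mult.assoc)
  qed
  also have "\<dots> = ennreal (2 / \<alpha> * (real n + 1)) * (1 + ennreal_of_enat (mixing_time M (lazy M h) \<pi>) / of_nat k)"
  proof -
    have "ennreal (real tl / real k) = of_nat tl / of_nat k"
      using \<open>0 < k\<close> by (simp add: divide_ennreal[symmetric] ennreal_of_nat_eq_real_of_nat)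
    then have "ennreal (1 + real tl / real k) = 1 + of_nat tl / of_nat k"
      by (simp add: ennreal_plus[of 1])
    then show ?thesis
      using \<open>0 < \<alpha>\<close> unfolding enat ennreal_of_enat_enat by (subst ennreal_mult) auto
  qed
  finally show ?thesis .
qed

text \<open>With hitting time \<open>H\<close> and \<open>t\<close> the ceiling of
  \<open>32 * H\<close>, the hypothesis \<open>H1\<close> yields \<open>t \<le> 33 * H\<close>.
  Waiting time \<open>C * t\<close> and window \<open>t\<close> give convergence in
  \<open>(C + 1) * t\<close> steps, and laziness multiplies by 10; hence 330 = 10 * 33.\<close>

lemma mixing_time_lazy_skeleton_le:
  assumes "0 < k" and C: "4096 \<le> (1/2 - \<alpha>) * real C"
    and H1: "1 \<le> max_hitting_time M (skeleton M k (lazy M h)) \<pi> \<alpha>"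
  shows "ennreal (1 / (330 * (real C + 1))) *
      ennreal_of_enat (mixing_time M (lazy M (skeleton M k (lazy M h))) \<pi>)
    \<le> max_hitting_time M (skeleton M k (lazy M h)) \<pi> \<alpha>" (is "_ \<le> ?H")
proof (cases ?H)
  case top
  then show ?thesis by simp
next
  case (real H)
  interpret P: kernel M "skeleton M k (lazy M h)"
    unfolding skeleton_def by unfold_locales (rule lz.steps_markov)
  have H: "1 \<le> H" using H1 real by (simp flip: ennreal_1)
  define t where "t = nat \<lceil>32 * H\<rceil>"
  have t: "32 * H \<le> real t" "real t \<le> 33 * H" using H unfolding t_def by linarith+
  have t0: "t > 0" using t H by (intro Nat.gr0I) auto
  \<comment> \<open>Markov's inequality for the hitting time: \<open>avoid\<close> decreases in
    time, so \<open>t\<close> times its value at \<open>t\<close> is below the tail sum, which is at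
    most \<open>H\<close>.\<close>
  have av: "P.avoid D t x \<le> 1/32" if D: "D \<in> sets M" "\<alpha> \<le> measure \<pi> D" and x: "x \<in> space M" for D x
  proof -
    have "(\<Sum>n. ennreal (P.avoid D n x)) \<le> ?H"
      unfolding P.nn_integral_hitting_time[OF x D(1), symmetric] max_hitting_time_def
      using D x by (intro Sup_upper) auto
    moreover have "ennreal (\<Sum>n<t. P.avoid D n x) \<le> (\<Sum>n. ennreal (P.avoid D n x))"
    proof -
      have "ennreal (\<Sum>n<t. P.avoid D n x) = (\<Sum>n<t. ennreal (P.avoid D n x))"
        using P.avoid_bounds[OF D(1) x] by (intro sum_ennreal[symmetric])
      also have "\<dots> \<le> (\<Sum>n. ennreal (P.avoid D n x))" by (intro sum_le_suminf) auto
      finally show ?thesis .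
    qed
    ultimately have "ennreal (\<Sum>n<t. P.avoid D n x) \<le> ennreal H"
      unfolding real(2) by (rule order_trans[rotated])
    then have "(\<Sum>n<t. P.avoid D n x) \<le> H" using real(1) ennreal_le_iff by blast
    moreover have "(\<Sum>n<t. P.avoid D t x) \<le> (\<Sum>n<t. P.avoid D n x)"
      by (intro sum_mono P.avoid_decseq D x) auto
    ultimately have "real t * P.avoid D t x \<le> H" by simp
    moreover have "32 * H * P.avoid D t x \<le> real t * P.avoid D t x"
      using t P.avoid_bounds[OF D(1) x] by (intro mult_right_mono) auto
    ultimately have "H * (32 * P.avoid D t x) \<le> H * 1" by simp
    then show ?thesis using H by simp
  qed
  have ne: "space M \<noteq> {}" using pi.not_empty space_pi by simp
  have "mixing_time M (lazy M (skeleton M k (lazy M h))) \<pi> \<le> enat (10 * (C * t + t))"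
  proof (rule P.mixing_time_lazy_le[OF prob_pi ne])
    show "1 \<le> C * t + t" using t0 by simp
    fix A j x assume A: "A \<in> sets M" and j: "C * t + t \<le> j" and x: "x \<in> space M"
    have bA: "bounded_measurable M (indicator A)" using A by simp
    have *: "\<bar>(kact (skeleton M k (lazy M h)) ^^ (C * t + t)) (indicator A) y - measure \<pi> A\<bar> \<le> 1/8"
      if y: "y \<in> space M" for y
      unfolding skeleton_def
    proof (rule skeleton_deviation_le[OF A \<open>0 < k\<close> t0 _ _ y])
      have "4096 * real t \<le> (1/2 - \<alpha>) * real C * real t" using C by (intro mult_right_mono) auto
      then show "4096 * real t \<le> (1/2 - \<alpha>) * real (C * t)" by (simp add: mult.assoc)
    qed (use av in \<open>auto simp: skeleton_def\<close>)
    obtain r where r: "j = r + (C * t + t)" using j by (metis add.commute le_Suc_ex)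
    show "\<bar>(kact (skeleton M k (lazy M h)) ^^ j) (indicator A) x - measure \<pi> A\<bar> \<le> 1/8"
      unfolding r funpow_add[of r] comp_apply
      by (rule P.kact_iter_deviation_mono[OF P.kact_iter_bounded_measurable[OF bA] * x])
  qed
  then have "ennreal_of_enat (mixing_time M (lazy M (skeleton M k (lazy M h))) \<pi>) \<le>
      ennreal_of_enat (enat (10 * (C * t + t)))"
    by (simp only: ennreal_of_enat_le_iff)
  then have "ennreal (1 / (330 * (real C + 1))) * ennreal_of_enat (mixing_time M (lazy M (skeleton M k (lazy M h))) \<pi>)
    \<le> ennreal (1 / (330 * (real C + 1))) * ennreal (real (10 * (C * t + t)))"
    by (intro mult_left_mono) (auto simp: ennreal_of_nat_eq_real_of_nat)
  also have "\<dots> = ennreal (1 / (330 * (real C + 1)) * real (10 * (C * t + t)))"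
    by (rule ennreal_mult[symmetric]) auto
  also have "1 / (330 * (real C + 1)) * real (10 * (C * t + t)) = real t / 33"
    by (simp add: divide_simps) (simp add: algebra_simps)
  also have "ennreal (real t / 33) \<le> ennreal H" using t by (intro ennreal_leI) simp
  finally show ?thesis using real by simp
qed

end

section \<open>The Metropolis--Hastings kernel\<close>

text \<open>Needed to evaluate \<open>mh_kernel\<close>, which is given through
  \<open>measure_of\<close>: there \<open>\<mu>\<close> is the accepted part, \<open>\<nu>\<close>
  the point mass at the current state and \<open>c\<close> the rejection probability.\<close>

lemma emeasure_measure_of_add:
  assumes s: "sets \<mu> = sets M" "sets \<nu> = sets M" and A: "A \<in> sets M"
  shows "emeasure (measure_of (space M) (sets M) (\<lambda>A. emeasure \<mu> A + emeasure \<nu> A * c)) A =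
    emeasure \<mu> A + emeasure \<nu> A * c"
proof (rule emeasure_measure_of_sigma[OF sets.sigma_algebra_axioms _ _ A])
  show "positive (sets M) (\<lambda>A. emeasure \<mu> A + emeasure \<nu> A * c)" by (simp add: positive_def)
  show "countably_additive (sets M) (\<lambda>A. emeasure \<mu> A + emeasure \<nu> A * c)"
  proof (rule countably_additiveI)
    fix F :: "nat \<Rightarrow> _ set" assume F: "range F \<subseteq> sets M" "disjoint_family F"
    have "(\<Sum>i. emeasure \<mu> (F i) + emeasure \<nu> (F i) * c) =
        (\<Sum>i. emeasure \<mu> (F i)) + (\<Sum>i. emeasure \<nu> (F i) * c)"
      by (rule suminf_add[symmetric]) auto
    also have "(\<Sum>i. emeasure \<nu> (F i) * c) = (\<Sum>i. emeasure \<nu> (F i)) * c" by simp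
    also have "(\<Sum>i. emeasure \<mu> (F i)) = emeasure \<mu> (\<Union>i. F i)"
      using F s by (intro suminf_emeasure) auto
    also have "(\<Sum>i. emeasure \<nu> (F i)) = emeasure \<nu> (\<Union>i. F i)"
      using F s by (intro suminf_emeasure) auto
    finally show "(\<Sum>i. emeasure \<mu> (F i) + emeasure \<nu> (F i) * c) =
      emeasure \<mu> (\<Union>i. F i) + emeasure \<nu> (\<Union>i. F i) * c" .
  qed
qed

section \<open>Borel and Lebesgue structure of R^d inside the space of sequences\<close>

lemma space_leb: "Rd d = {\<omega>. \<forall>i\<ge>d. \<omega> i = undefined}"
  by (simp add: leb_def space_PiM PiE_def Pi_def extensional_def lessThan_iff not_less set_eq_iff)

lemma closed_Rd: "closed (Rd d)"
proof -
  have "Rd d = (\<Inter>i\<in>{d..}. {\<omega>. \<omega> i = undefined})" unfolding space_leb by auto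
  moreover have "closed {\<omega> :: point. \<omega> i = c}" for i c
    by (intro closed_Collect_eq continuous_on_product_coordinates continuous_on_const)
  ultimately show ?thesis by auto
qed

text \<open>Continuity is stated in the topology of all sequences, measurability in the product over
  the first \<open>d\<close> coordinates. The inclusion links the two, because the remaining
  coordinates are constant on \<open>Rd d\<close>.\<close>

lemma id_leb_borel [measurable]: "(\<lambda>\<omega>. \<omega>) \<in> leb d \<rightarrow>\<^sub>M (borel :: point measure)"
proof -
  have "(\<lambda>\<omega>. \<omega>) \<in> leb d \<rightarrow>\<^sub>M Pi\<^sub>M UNIV (\<lambda>i::nat. borel :: real measure)"
  proof (rule measurable_PiM_single')
    fix i :: nat
    show "(\<lambda>\<omega>. \<omega> i) \<in> leb d \<rightarrow>\<^sub>M (borel :: real measure)"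
    proof (cases "i < d")
      case True
      then show ?thesis unfolding leb_def
        by (intro measurable_component_singleton[THEN measurable_compose, where g="\<lambda>x. x"]) auto
    next
      case False
      then have "(\<lambda>\<omega>. \<omega> i) \<in> leb d \<rightarrow>\<^sub>M (borel :: real measure) \<longleftrightarrow>
        (\<lambda>\<omega>. undefined) \<in> leb d \<rightarrow>\<^sub>M (borel :: real measure)"
        by (intro measurable_cong) (auto simp: space_leb)
      then show ?thesis by simp
    qed
  qed auto
  then show ?thesis
    using measurable_cong_sets[OF refl sets_PiM_equal_borel, of "leb d"] by blast
qed

text \<open>\<open>Rd d\<close> is closed, so extension by 0 gives a Borel function on all
  sequences, which is then composed with the inclusion.\<close>

lemma borel_measurable_leb_continuous:
  assumes "continuous_on (Rd d) (f :: point \<Rightarrow> real)"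
  shows "f \<in> borel_measurable (leb d)"
proof -
  have "(\<lambda>x. if x \<in> Rd d then f x else 0) \<in> borel_measurable borel"
    using assms closed_Rd by (intro borel_measurable_continuous_on_if) auto
  from measurable_compose[OF id_leb_borel this]
  have "(\<lambda>x. if x \<in> Rd d then f x else 0) \<in> borel_measurable (leb d)" .
  then show ?thesis by (subst measurable_cong[of _ _ "\<lambda>x. if x \<in> Rd d then f x else 0"]) auto
qed

lemma borel_measurable_leb_pair_continuous:
  assumes "continuous_on (Rd d \<times> Rd d) (\<lambda>(x, y). f x y :: real)"
  shows "(\<lambda>(x, y). f x y) \<in> borel_measurable (leb d \<Otimes>\<^sub>M leb d)"
proof -
  let ?g = "\<lambda>z. if z \<in> Rd d \<times> Rd d then (\<lambda>(x, y). f x y) z else 0"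
  have g: "?g \<in> borel_measurable borel"
    using assms closed_Rd by (intro borel_measurable_continuous_on_if) (auto intro: borel_closed closed_Times)
  have "(\<lambda>z. (fst z, snd z)) \<in> leb d \<Otimes>\<^sub>M leb d \<rightarrow>\<^sub>M (borel :: point measure) \<Otimes>\<^sub>M (borel :: point measure)"
    by (intro measurable_Pair measurable_compose[OF measurable_fst id_leb_borel]
        measurable_compose[OF measurable_snd id_leb_borel])
  then have "(\<lambda>z. z) \<in> leb d \<Otimes>\<^sub>M leb d \<rightarrow>\<^sub>M (borel :: (point \<times> point) measure)"
    by (simp add: borel_prod)
  from measurable_compose[OF this g]
  have "?g \<in> borel_measurable (leb d \<Otimes>\<^sub>M leb d)" .
  then show ?thesis
    by (subst measurable_cong[of _ _ ?g]) (auto simp: space_pair_measure)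
qed

lemma sigma_finite_leb: "sigma_finite_measure (leb d)"
proof -
  interpret product_sigma_finite "\<lambda>_::nat. lborel :: real measure" by unfold_locales
  show ?thesis unfolding leb_def by (rule sigma_finite) simp
qed

text \<open>A point is a box with sides of length zero; \<open>d \<ge> 1\<close> guarantees at least
  one side.\<close>

lemma leb_singleton_null:
  assumes "d \<ge> 1" "x \<in> Rd d"
  shows "{x} \<in> sets (leb d)" "emeasure (leb d) {x} = 0"
proof -
  interpret product_sigma_finite "\<lambda>_::nat. lborel :: real measure" by unfold_locales
  have x: "{x} = Pi\<^sub>E {..<d} (\<lambda>i. {x i})"
    using assms(2) by (auto simp: leb_def space_PiM PiE_iff extensional_def fun_eq_iff) (metis lessThan_iff)
  show "{x} \<in> sets (leb d)"
    unfolding leb_def by (subst x) (auto intro!: sets_PiM_I_finite)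
  have "emeasure (leb d) {x} = (\<Prod>i<d. emeasure lborel {x i})"
    unfolding leb_def by (subst x, subst emeasure_PiM) auto
  also have "\<dots> = 0" using assms(1) by (simp add: prod_zero_iff)
  finally show "emeasure (leb d) {x} = 0" .
qed

section \<open>Measurability, detailed balance and reversibility of the Metropolis-Hastings
  kernel\<close>

context
  fixes d :: nat and \<rho> :: "point \<Rightarrow> real" and q :: "point \<Rightarrow> point \<Rightarrow> real" and \<phi> :: "point \<Rightarrow> real"
  assumes mh: "mh_class d \<rho> q \<phi>"
begin

lemma target_density: "\<rho> \<in> borel_measurable (leb d)" "\<And>x. x \<in> Rd d \<Longrightarrow> 0 \<le> \<rho> x" "prob_space (dens d \<rho>)" "d \<ge> 1"
  using mh unfolding mh_class_def mh_data_def cont_density_def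
  by (auto intro: borel_measurable_leb_continuous)

text \<open>Joint continuity enters here: it makes \<open>q\<close> jointly measurable, as the
  Fubini argument for reversibility requires.\<close>

lemma proposal_density: "(\<lambda>(x, y). q x y) \<in> borel_measurable (leb d \<Otimes>\<^sub>M leb d)"
  "\<And>x y. x \<in> Rd d \<Longrightarrow> y \<in> Rd d \<Longrightarrow> 0 \<le> q x y"
  "\<And>x. x \<in> Rd d \<Longrightarrow> (\<integral>\<^sup>+y. ennreal (q x y) \<partial>leb d) = 1"
proof -
  show "(\<lambda>(x, y). q x y) \<in> borel_measurable (leb d \<Otimes>\<^sub>M leb d)"
    using mh unfolding mh_class_def by (auto intro: borel_measurable_leb_pair_continuous)
  show "0 \<le> q x y" if "x \<in> Rd d" "y \<in> Rd d" for x y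
    using mh that unfolding mh_class_def mh_data_def cont_density_def by auto
  fix x assume x: "x \<in> Rd d"
  then have "prob_space (dens d (q x))"
    using mh unfolding mh_class_def mh_data_def markov_kernel_def
    by (auto dest: measurable_space simp: space_prob_algebra)
  from prob_space.emeasure_space_1[OF this]
  have "(\<integral>\<^sup>+y. ennreal (q x y) * indicator (Rd d) y \<partial>leb d) = 1"
    using mh x unfolding mh_class_def mh_data_def cont_density_def
    by (simp add: emeasure_density borel_measurable_leb_continuous)
  moreover have "(\<integral>\<^sup>+y. ennreal (q x y) * indicator (Rd d) y \<partial>leb d) = (\<integral>\<^sup>+y. ennreal (q x y) \<partial>leb d)"
    by (intro nn_integral_cong) auto
  ultimately show "(\<integral>\<^sup>+y. ennreal (q x y) \<partial>leb d) = 1" by simp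
qed

lemmas [measurable] = target_density(1) proposal_density(1)

lemma q_measurable [measurable (raw)]:
  assumes [measurable]: "f \<in> N \<rightarrow>\<^sub>M leb d" "g \<in> N \<rightarrow>\<^sub>M leb d"
  shows "(\<lambda>z. q (f z) (g z)) \<in> borel_measurable N"
  using measurable_compose[OF measurable_Pair[OF assms] proposal_density(1)] by simp

lemma accept_measurable [measurable (raw)]:
  assumes [measurable]: "f \<in> N \<rightarrow>\<^sub>M leb d" "g \<in> N \<rightarrow>\<^sub>M leb d"
  shows "(\<lambda>z. mh_accept \<rho> q (f z) (g z)) \<in> borel_measurable N"
  unfolding mh_accept_def by measurable

lemma accept_bounds:
  assumes "x \<in> Rd d" "y \<in> Rd d"
  shows "0 \<le> mh_accept \<rho> q x y" "mh_accept \<rho> q x y \<le> 1"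
  using assms target_density(2) proposal_density(2) unfolding mh_accept_def by (auto intro!: divide_nonneg_nonneg mult_nonneg_nonneg)

text \<open>Detailed balance: both sides are the minimum of the two flows.\<close>

lemma flow_symmetric:
  assumes "x \<in> Rd d" "y \<in> Rd d"
  shows "\<rho> x * (q x y * mh_accept \<rho> q x y) = \<rho> y * (q y x * mh_accept \<rho> q y x)"
proof -
  have *: "\<rho> x * (q x y * mh_accept \<rho> q x y) = min (\<rho> x * q x y) (\<rho> y * q y x)"
    if "x \<in> Rd d" "y \<in> Rd d" for x y
  proof -
    have "0 \<le> \<rho> x * q x y" "0 \<le> \<rho> y * q y x"
      using that target_density(2) proposal_density(2) by (auto intro!: mult_nonneg_nonneg)
    moreover have "a * (if a = 0 then 1 else min 1 (b / a)) = min a b" if "0 \<le> a" "0 \<le> b" for a b :: real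
      using that by (cases "a = 0"; cases "a \<le> b") (auto simp: min_def pos_le_divide_eq)
    ultimately show ?thesis
      unfolding mh_accept_def mult.assoc[symmetric] by blast
  qed
  show ?thesis unfolding *[OF assms] *[OF assms(2,1)] by (rule min.commute)
qed

definition stay :: "point \<Rightarrow> ennreal" where
  "stay x = (\<integral>\<^sup>+y. ennreal (q x y * (1 - mh_accept \<rho> q x y)) \<partial>leb d)"

lemma stay_measurable [measurable]: "stay \<in> borel_measurable (leb d)"
proof -
  interpret sigma_finite_measure "leb d" by (rule sigma_finite_leb)
  show ?thesis unfolding stay_def[abs_def] by measurable
qed

lemma emeasure_mh_kernel:
  assumes x: "x \<in> Rd d" and A: "A \<in> sets (leb d)"
  shows "emeasure (mh_kernel d \<rho> q x) A =
    (\<integral>\<^sup>+y\<in>A. ennreal (q x y * mh_accept \<rho> q x y) \<partial>leb d) + indicator A x * stay x"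
proof -
  let ?\<mu> = "density (leb d) (\<lambda>y. ennreal (q x y * mh_accept \<rho> q x y))"
  have [measurable]: "(\<lambda>y. ennreal (q x y * mh_accept \<rho> q x y)) \<in> borel_measurable (leb d)"
    using x by measurable
  have eq: "(\<integral>\<^sup>+y\<in>A. ennreal (q x y * mh_accept \<rho> q x y) \<partial>leb d) + indicator A x * stay x =
    emeasure ?\<mu> A + emeasure (return (leb d) x) A * stay x" if "A \<in> sets (leb d)" for A
    using that by (simp add: emeasure_density emeasure_return)
  have "mh_kernel d \<rho> q x = measure_of (space (leb d)) (sets (leb d))
      (\<lambda>A. emeasure ?\<mu> A + emeasure (return (leb d) x) A * stay x)"
    unfolding mh_kernel_def stay_def[symmetric]
    by (intro measure_of_eq sets.space_closed) (simp only: sets.sigma_sets_eq eq)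
  then have "emeasure (mh_kernel d \<rho> q x) A = emeasure ?\<mu> A + emeasure (return (leb d) x) A * stay x"
    using emeasure_measure_of_add[OF _ _ A, of ?\<mu> "return (leb d) x" "stay x"] by simp
  then show ?thesis using eq[OF A] by simp
qed

lemma sets_mh_kernel: "sets (mh_kernel d \<rho> q x) = sets (leb d)"
  by (simp add: mh_kernel_def)

lemma mh_kernel_markov: "markov_kernel (leb d) (mh_kernel d \<rho> q)"
  unfolding markov_kernel_def
proof (intro measurable_prob_algebraI measurable_subprob_algebra)
  show ps: "prob_space (mh_kernel d \<rho> q x)" if x: "x \<in> Rd d" for x
  proof (rule prob_spaceI)
    have sp: "space (mh_kernel d \<rho> q x) = Rd d" using sets_mh_kernel by (rule sets_eq_imp_space_eq)
    have m1: "(\<lambda>y. ennreal (q x y * mh_accept \<rho> q x y)) \<in> borel_measurable (leb d)"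
      "(\<lambda>y. ennreal (q x y * (1 - mh_accept \<rho> q x y))) \<in> borel_measurable (leb d)"
      using x by measurable
    have "emeasure (mh_kernel d \<rho> q x) (Rd d) =
      (\<integral>\<^sup>+y. ennreal (q x y * mh_accept \<rho> q x y) \<partial>leb d) + stay x"
      using x by (simp add: emeasure_mh_kernel)
    also have "\<dots> = (\<integral>\<^sup>+y. ennreal (q x y * mh_accept \<rho> q x y) + ennreal (q x y * (1 - mh_accept \<rho> q x y)) \<partial>leb d)"
      unfolding stay_def by (rule nn_integral_add[OF m1, symmetric])
    also have "\<dots> = (\<integral>\<^sup>+y. ennreal (q x y) \<partial>leb d)"
    proof (intro nn_integral_cong)
      fix y assume y: "y \<in> Rd d"
      have "0 \<le> q x y * mh_accept \<rho> q x y" "0 \<le> q x y * (1 - mh_accept \<rho> q x y)"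
        using accept_bounds[OF x y] proposal_density(2)[OF x y] by auto
      then have "ennreal (q x y * mh_accept \<rho> q x y + q x y * (1 - mh_accept \<rho> q x y)) =
          ennreal (q x y * mh_accept \<rho> q x y) + ennreal (q x y * (1 - mh_accept \<rho> q x y))"
        by (rule ennreal_plus)
      then show "ennreal (q x y * mh_accept \<rho> q x y) + ennreal (q x y * (1 - mh_accept \<rho> q x y)) =
          ennreal (q x y)"
        by (simp add: distrib_left[symmetric])
    qed
    also have "\<dots> = 1" using proposal_density(3)[OF x] .
    finally show "emeasure (mh_kernel d \<rho> q x) (space (mh_kernel d \<rho> q x)) = 1" unfolding sp .
  qed
  then show "subprob_space (mh_kernel d \<rho> q x)" if "x \<in> Rd d" for x
    using that by (intro prob_space_imp_subprob_space)
  fix A assume A [measurable]: "A \<in> sets (leb d)"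
  interpret sigma_finite_measure "leb d" by (rule sigma_finite_leb)
  have "(\<lambda>x. emeasure (mh_kernel d \<rho> q x) A) \<in> borel_measurable (leb d) \<longleftrightarrow>
    (\<lambda>x. (\<integral>\<^sup>+y\<in>A. ennreal (q x y * mh_accept \<rho> q x y) \<partial>leb d) + indicator A x * stay x)
      \<in> borel_measurable (leb d)"
    using A by (intro measurable_cong emeasure_mh_kernel)
  also have "\<dots>" by measurable
  finally show "(\<lambda>x. emeasure (mh_kernel d \<rho> q x) A) \<in> borel_measurable (leb d)" .
qed (simp add: sets_mh_kernel)

text \<open>The flow splits into accepted moves, symmetric by detailed balance and Fubini, and
  rejected moves, which stay on the diagonal and contribute an integral over
  \<open>A \<inter> B\<close>.\<close>

lemma mh_kernel_reversible: "reversible (leb d) (mh_kernel d \<rho> q) (dens d \<rho>)"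
  unfolding reversible_def
proof (intro ballI)
  interpret sigma_finite_measure "leb d" by (rule sigma_finite_leb)
  interpret L: pair_sigma_finite "leb d" "leb d" ..
  let ?w = "\<lambda>x y. ennreal (\<rho> x * (q x y * mh_accept \<rho> q x y))"
  have [measurable]: "(\<lambda>(x, y). ?w x y) \<in> borel_measurable (leb d \<Otimes>\<^sub>M leb d)" by measurable
  have *: "(\<integral>\<^sup>+x\<in>A. emeasure (mh_kernel d \<rho> q x) B \<partial>dens d \<rho>) =
    (\<integral>\<^sup>+x. \<integral>\<^sup>+y. ?w x y * indicator A x * indicator B y \<partial>leb d \<partial>leb d) +
    (\<integral>\<^sup>+x. ennreal (\<rho> x) * stay x * indicator (A \<inter> B) x \<partial>leb d)"
    if A [measurable]: "A \<in> sets (leb d)" and B [measurable]: "B \<in> sets (leb d)" for A B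
  proof -
    have "(\<integral>\<^sup>+x\<in>A. emeasure (mh_kernel d \<rho> q x) B \<partial>dens d \<rho>) =
      (\<integral>\<^sup>+x\<in>A. (\<integral>\<^sup>+y\<in>B. ennreal (q x y * mh_accept \<rho> q x y) \<partial>leb d) + indicator B x * stay x \<partial>dens d \<rho>)"
      by (intro nn_integral_cong) (simp add: emeasure_mh_kernel B)
    also have "\<dots> = (\<integral>\<^sup>+x. ennreal (\<rho> x) * (((\<integral>\<^sup>+y\<in>B. ennreal (q x y * mh_accept \<rho> q x y) \<partial>leb d) + indicator B x * stay x) * indicator A x) \<partial>leb d)"
      by (rule nn_integral_density) measurable
    also have "\<dots> = (\<integral>\<^sup>+x. (\<integral>\<^sup>+y. ?w x y * indicator A x * indicator B y \<partial>leb d) +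
        ennreal (\<rho> x) * stay x * indicator (A \<inter> B) x \<partial>leb d)"
    proof (intro nn_integral_cong)
      fix x assume x: "x \<in> Rd d"
      have [measurable]: "(\<lambda>y. ennreal (q x y * mh_accept \<rho> q x y)) \<in> borel_measurable (leb d)"
        using x by measurable
      have "ennreal (\<rho> x) * (\<integral>\<^sup>+y\<in>B. ennreal (q x y * mh_accept \<rho> q x y) \<partial>leb d) * indicator A x =
        (\<integral>\<^sup>+y. ennreal (\<rho> x) * (ennreal (q x y * mh_accept \<rho> q x y) * indicator B y) * indicator A x \<partial>leb d)"
        by (simp add: nn_integral_cmult nn_integral_multc)
      also have "\<dots> = (\<integral>\<^sup>+y. ?w x y * indicator A x * indicator B y \<partial>leb d)"
        using x target_density(2) proposal_density(2) accept_bounds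
        by (intro nn_integral_cong) (simp add: ennreal_mult mult_ac)
      finally show "ennreal (\<rho> x) * (((\<integral>\<^sup>+y\<in>B. ennreal (q x y * mh_accept \<rho> q x y) \<partial>leb d) + indicator B x * stay x) * indicator A x)
        = (\<integral>\<^sup>+y. ?w x y * indicator A x * indicator B y \<partial>leb d) + ennreal (\<rho> x) * stay x * indicator (A \<inter> B) x"
        by (simp add: distrib_left distrib_right mult_ac indicator_inter_arith)
    qed
    also have "\<dots> = (\<integral>\<^sup>+x. \<integral>\<^sup>+y. ?w x y * indicator A x * indicator B y \<partial>leb d \<partial>leb d) +
      (\<integral>\<^sup>+x. ennreal (\<rho> x) * stay x * indicator (A \<inter> B) x \<partial>leb d)"
      by (rule nn_integral_add) measurable
    finally show ?thesis .
  qed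
  fix A B assume A [measurable]: "A \<in> sets (leb d)" and B [measurable]: "B \<in> sets (leb d)"
  have "(\<integral>\<^sup>+x. \<integral>\<^sup>+y. ?w x y * indicator A x * indicator B y \<partial>leb d \<partial>leb d) =
    (\<integral>\<^sup>+y. \<integral>\<^sup>+x. ?w x y * indicator A x * indicator B y \<partial>leb d \<partial>leb d)"
    by (rule L.Fubini'[symmetric]) measurable
  also have "\<dots> = (\<integral>\<^sup>+y. \<integral>\<^sup>+x. ?w y x * indicator B y * indicator A x \<partial>leb d \<partial>leb d)"
    by (intro nn_integral_cong) (simp add: flow_symmetric mult_ac)
  finally show "(\<integral>\<^sup>+x\<in>A. emeasure (mh_kernel d \<rho> q x) B \<partial>dens d \<rho>) =
    (\<integral>\<^sup>+x\<in>B. emeasure (mh_kernel d \<rho> q x) A \<partial>dens d \<rho>)"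
    unfolding *[OF A B] *[OF B A] by (simp add: Int_commute)
qed

lemma mh_rev_kernel: "rev_kernel (leb d) (mh_kernel d \<rho> q) (dens d \<rho>)"
  by (intro rev_kernel.intro kernel.intro rev_kernel_axioms.intro mh_kernel_markov
      mh_kernel_reversible target_density) simp

end

text \<open>Started at \<open>x\<close>, the complement of \<open>x\<close> is not hit at time 0, so
  the term n = 0 of the tail sum is already 1.\<close>

lemma one_le_max_hitting_time:
  assumes k: "kernel M h" and x: "x \<in> space M" "{x} \<in> sets M"
    and \<alpha>: "\<alpha> \<le> measure \<pi> (space M - {x})"
  shows "1 \<le> max_hitting_time M h \<pi> \<alpha>"
proof -
  interpret kernel M h by (rule k)
  let ?A = "space M - {x}"
  have A: "?A \<in> sets M" using x by auto
  have "1 = ennreal (avoid ?A 0 x)" by simp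
  also have "\<dots> \<le> (\<Sum>n. ennreal (avoid ?A n x))"
    using sum_le_suminf[of "\<lambda>n. ennreal (avoid ?A n x)" "{0}"] by simp
  also have "\<dots> \<le> max_hitting_time M h \<pi> \<alpha>"
    unfolding nn_integral_hitting_time[OF x(1) A, symmetric] max_hitting_time_def
    using A x \<alpha> by (intro Sup_upper) auto
  finally show ?thesis .
qed

text \<open>The target has a density, so a point is null and its complement has full
  measure.\<close>

lemma one_le_max_hitting_time_mh:
  assumes mh: "mh_class d \<rho> q \<phi>" and k: "kernel (leb d) h" and "\<alpha> \<le> 1"
  shows "1 \<le> max_hitting_time (leb d) h (dens d \<rho>) \<alpha>"
proof -
  note rp = target_density[OF mh]
  interpret pi: prob_space "dens d \<rho>" by (rule rp)
  obtain x where x: "x \<in> Rd d" using pi.not_empty by auto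
  note n = leb_singleton_null[OF rp(4) x]
  have "(\<integral>\<^sup>+y. ennreal (\<rho> y) * indicator {x} y \<partial>leb d) = 0"
    using n by (intro nn_integral_null_set) (auto intro: null_setsI)
  then have "emeasure (dens d \<rho>) {x} = 0"
    using n rp(1) by (subst emeasure_density) auto
  then have "measure (dens d \<rho>) (Rd d - {x}) = 1"
    using n pi.prob_compl[of "{x}"] by (simp add: measure_def)
  then show ?thesis using n x \<open>\<alpha> \<le> 1\<close> by (intro one_le_max_hitting_time[OF k x]) auto
qed

theorem theoremB1:
  shows "\<exists>K::real. 0 < K \<and>
    (\<forall>\<alpha>::real. 0 < \<alpha> \<and> \<alpha> < 1/2 \<longrightarrow>
      (\<exists>c c' :: real. 0 < c \<and> 0 < c' \<and>
        (\<forall>d \<rho> q \<phi>. mh_class d \<rho> q \<phi> \<longrightarrow>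
          (let M = leb d;
               \<pi> = dens d \<rho>;
               gL = lazy M (mh_kernel d \<rho> q);
               tL = mixing_time M gL \<pi>
           in \<forall>k::nat.
                ennreal K * min (inverse (mh_gamma d \<rho> q)) (ennreal_of_enat tL)
                  * ennreal (ln (real (the_enat tL))) < of_nat k \<longrightarrow>
                (let gk = skeleton M k gL;
                     T = mixing_time M (lazy M gk) \<pi>;
                     H = max_hitting_time M gk \<pi> \<alpha>
                 in ennreal c * ennreal_of_enat T \<le> H \<and>
                    H \<le> ennreal c' * (1 + ennreal_of_enat tL / of_nat k))))))"
proof (rule exI[of _ 1], intro conjI allI impI)
  show "(0::real) < 1" by simp
  fix \<alpha> :: real assume \<alpha>: "0 < \<alpha> \<and> \<alpha> < 1/2"
  \<comment> \<open>The number of mixing times of the lazy kernel after which the deviation, halved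
    each time, is at most \<open>\<alpha> / 2\<close>.\<close>
  obtain n where n: "(1/2)^n \<le> \<alpha> / 2"
    using real_arch_pow_inv[of "\<alpha> / 2" "1/2"] \<alpha> by (auto intro: less_imp_le)
  \<comment> \<open>The ratio of waiting time to window; it grows without bound as
    \<open>\<alpha>\<close> approaches 1/2.\<close>
  obtain C :: nat where "4096 / (1/2 - \<alpha>) \<le> real C" using real_arch_simple by blast
  then have C: "4096 \<le> (1/2 - \<alpha>) * real C" using \<alpha> by (simp add: pos_divide_le_eq mult.commute)
  show "\<exists>c c' :: real. 0 < c \<and> 0 < c' \<and>
        (\<forall>d \<rho> q \<phi>. mh_class d \<rho> q \<phi> \<longrightarrow>
          (let M = leb d;
               \<pi> = dens d \<rho>;
               gL = lazy M (mh_kernel d \<rho> q);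
               tL = mixing_time M gL \<pi>
           in \<forall>k::nat.
                ennreal 1 * min (inverse (mh_gamma d \<rho> q)) (ennreal_of_enat tL)
                  * ennreal (ln (real (the_enat tL))) < of_nat k \<longrightarrow>
                (let gk = skeleton M k gL;
                     T = mixing_time M (lazy M gk) \<pi>;
                     H = max_hitting_time M gk \<pi> \<alpha>
                 in ennreal c * ennreal_of_enat T \<le> H \<and>
                    H \<le> ennreal c' * (1 + ennreal_of_enat tL / of_nat k))))"
    unfolding Let_def
  proof (rule exI[of _ "1 / (330 * (real C + 1))"], rule exI[of _ "2 / \<alpha> * (real n + 1)"],
      intro conjI allI impI)
    show "0 < 1 / (330 * (real C + 1))" "0 < 2 / \<alpha> * (real n + 1)" using \<alpha> by auto
    fix d \<rho> q \<phi> and k :: nat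
    assume mh: "mh_class d \<rho> q \<phi>"
      and less: "ennreal 1 * min (inverse (mh_gamma d \<rho> q))
          (ennreal_of_enat (mixing_time (leb d) (lazy (leb d) (mh_kernel d \<rho> q)) (dens d \<rho>)))
        * ennreal (ln (real (the_enat (mixing_time (leb d) (lazy (leb d) (mh_kernel d \<rho> q)) (dens d \<rho>)))))
        < of_nat k"
    interpret rev_kernel "leb d" "mh_kernel d \<rho> q" "dens d \<rho>" by (rule mh_rev_kernel[OF mh])
    \<comment> \<open>Nothing in \<open>ennreal\<close> lies strictly below 0.\<close>
    have k: "0 < k" using less by (cases k) auto
    have "kernel (leb d) (skeleton (leb d) k (lazy (leb d) (mh_kernel d \<rho> q)))"
      unfolding skeleton_def by unfold_locales (rule lz.steps_markov)
    then have H1: "1 \<le> max_hitting_time (leb d) (skeleton (leb d) k (lazy (leb d) (mh_kernel d \<rho> q))) (dens d \<rho>) \<alpha>"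
      using \<alpha> by (intro one_le_max_hitting_time_mh[OF mh]) auto
    show "ennreal (1 / (330 * (real C + 1))) *
        ennreal_of_enat (mixing_time (leb d) (lazy (leb d) (skeleton (leb d) k (lazy (leb d) (mh_kernel d \<rho> q)))) (dens d \<rho>))
      \<le> max_hitting_time (leb d) (skeleton (leb d) k (lazy (leb d) (mh_kernel d \<rho> q))) (dens d \<rho>) \<alpha>"
      by (rule mixing_time_lazy_skeleton_le[OF k C H1])
    show "max_hitting_time (leb d) (skeleton (leb d) k (lazy (leb d) (mh_kernel d \<rho> q))) (dens d \<rho>) \<alpha>
      \<le> ennreal (2 / \<alpha> * (real n + 1)) *
        (1 + ennreal_of_enat (mixing_time (leb d) (lazy (leb d) (mh_kernel d \<rho> q)) (dens d \<rho>)) / of_nat k)"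
      using \<alpha> by (intro max_hitting_time_skeleton_le[OF _ k n]) auto
  qed
qed

end
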